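(* Let $\ell > 3$ be a prime, let $m \ge 1$ be an integer, and let $a = \ell^e$ and $b = \ell^c u$, where $e > c \ge 2$ are integers and $u$ is an integer with $\gcd(\ell,u)=1$. If $c$ is even, $c \ge 2m$, and $-u$ is a square modulo $\ell$, then $$H(an+b) \equiv 0 \pmod{\ell^m}\quad\text{for all integers } n,$$ where $H(D)$ denotes the Hurwitz class number. In particular, for every prime $\ell > 3$ there exist $a \in \mathbb{Z}_{\ge 1}$ and $b \in \mathbb{Z}$ such that $-b$ is a square modulo $a$ and $H(an+b) \equiv 0 \pmod{\ell}$ for all integers $n$.
   Context: $H(D)$ denotes the $D$-th Hurwitz class number in Zagier's sign convention (nonnegative arguments): $H(0) = -\tfrac{1}{12}$; for $D > 0$, $H(D)$ is the number of $\mathrm{SL}_2(\mathbb{Z})$-equivalence classes of (not necessarily primitive) positive definite integral binary quadratic forms of discriminant $-D$, where classes containing a multiple of $x^2+y^2$ are counted with weight $\tfrac12$ and classes containing a multiple of $x^2+xy+y^2$ are counted with weight $\tfrac13$ (so $H(D)=0$ if $-D \not\equiv 0,1 \pmod 4$); and $H(D) = 0$ for $D < 0$. The values $H(D)$ are rational with denominators divisible only by the primes $2$ and $3$, so congruences modulo $\ell^m$ for a prime $\ell > 3$ are understood in the ring of $\ell$-integral rational numbers (rational numbers whose denominator is not divisible by $\ell$). *)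

theory Defs
  imports "HOL-Number_Theory.Number_Theory"
begin

text \<open>The triple \<open>(a, b, c)\<close> stands for the integral binary quadratic form
  \<open>a x\<^sup>2 + b x y + c y\<^sup>2\<close>.\<close>

type_synonym bqf = "int \<times> int \<times> int"

fun bqf_eval :: "bqf \<Rightarrow> int \<Rightarrow> int \<Rightarrow> int" where
  "bqf_eval (a, b, c) x y = a * x\<^sup>2 + b * x * y + c * y\<^sup>2"

fun bqf_disc :: "bqf \<Rightarrow> int" where
  "bqf_disc (a, b, c) = b\<^sup>2 - 4 * a * c"

definition bqf_pos_def :: "bqf \<Rightarrow> bool" where
  "bqf_pos_def f \<longleftrightarrow> (\<forall>x y. (x, y) \<noteq> (0, 0) \<longrightarrow> bqf_eval f x y > 0)"

text \<open>Equality of the values at all integer points is the same as equality of the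
  coefficients, so this says that \<open>g\<close> is \<open>f\<close> composed with the matrix with rows
  \<open>(p, q)\<close> and \<open>(r, s)\<close> in \<open>SL\<^sub>2(\<int>)\<close>.\<close>

definition bqf_equiv :: "bqf \<Rightarrow> bqf \<Rightarrow> bool" where
  "bqf_equiv f g \<longleftrightarrow> (\<exists>p q r s :: int. p * s - q * r = 1 \<and>
     (\<forall>x y. bqf_eval g x y = bqf_eval f (p * x + q * y) (r * x + s * y)))"

definition pos_forms :: "int \<Rightarrow> bqf set" where
  "pos_forms D = {f. bqf_pos_def f \<and> bqf_disc f = - D}"

definition form_classes :: "int \<Rightarrow> bqf set set" where
  "form_classes D =
     pos_forms D // {(f, g). f \<in> pos_forms D \<and> g \<in> pos_forms D \<and> bqf_equiv f g}"

definition class_weight :: "bqf set \<Rightarrow> rat" where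
  "class_weight C =
     (if \<exists>k. (k, 0, k) \<in> C then 1 / 2
      else if \<exists>k. (k, k, k) \<in> C then 1 / 3
      else 1)"

text \<open>For \<open>D > 0\<close> there are only finitely many classes (reduction theory), so the sum
  below is a genuine weighted count.\<close>

definition hurwitz_class_number :: "int \<Rightarrow> rat" where
  "hurwitz_class_number D =
     (if D = 0 then - 1 / 12
      else if D > 0 then (\<Sum>C\<in>form_classes D. class_weight C)
      else 0)"

text \<open>\<open>quotient_of\<close> returns numerator and denominator in lowest terms.\<close>

definition integral_at :: "int \<Rightarrow> rat set" where
  "integral_at l = {x. \<not> l dvd snd (quotient_of x)}"

text \<open>Congruence of \<open>l\<close>-integral rationals modulo the ideal generated by \<open>N\<close>.\<close>

definition rat_cong :: "int \<Rightarrow> rat \<Rightarrow> rat \<Rightarrow> int \<Rightarrow> bool" where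
  "rat_cong l x y N \<longleftrightarrow> x \<in> integral_at l \<and> y \<in> integral_at l \<and>
     (\<exists>z \<in> integral_at l. x - y = of_int N * z)"

end

theory Submission
  imports Defs
begin

text \<open>Up to the factor 2, \<open>H(D)\<close> is the sum of \<open>1 / |Stab f|\<close> over representatives \<open>f\<close> of the
  \<open>SL\<^sub>2(\<int>)\<close>-classes. Double counting the integral matrices of determinant \<open>l\<close> that carry a form
  of discriminant \<open>-D\<close> to one of discriminant \<open>-l\<^sup>2 D\<close> expresses \<open>(l + 1) H(D)\<close> as \<open>H(l\<^sup>2 D)\<close> plus a
  weighted count of forms \<open>f\<close> of discriminant \<open>-D\<close>, each with multiplicity one less than its
  number of zeros on the projective line over \<open>\<int> / l\<close>. If \<open>-D\<close> is a nonzero square modulo \<open>l\<close> every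
  form has two zeros, so \<open>H(l\<^sup>2 D) = l H(D)\<close>; if \<open>D = l\<^sup>2 D'\<close> only the forms divisible by \<open>l\<close>
  contribute, so \<open>H(l\<^sup>2 D) = (l + 1) H(D) - l H(D')\<close>. By induction \<open>H(l\<^sup>2\<^sup>k N) = l\<^sup>k H(N)\<close> for \<open>-N\<close> a
  nonzero square modulo \<open>l\<close>, and the argument \<open>a n + b\<close> has this form with \<open>2 k = c\<close>.\<close>

subsection \<open>The action of integral matrices\<close>

type_synonym mat2 = "int \<times> int \<times> int \<times> int"

fun mat_mul :: "mat2 \<Rightarrow> mat2 \<Rightarrow> mat2" (infixl \<open>\<cdot>\<close> 70) where
  "(p, q, r, s) \<cdot> (p', q', r', s') =
     (p * p' + q * r', p * q' + q * s', r * p' + s * r', r * q' + s * s')"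

fun mat_det :: "mat2 \<Rightarrow> int" where
  "mat_det (p, q, r, s) = p * s - q * r"

fun mat_adj :: "mat2 \<Rightarrow> mat2" where
  "mat_adj (p, q, r, s) = (s, - q, - r, p)"

text \<open>Transposition reverses products, so it turns a count by cosets \<open>SL2Z B\<close>
  into a count by cosets \<open>B SL2Z\<close>.\<close>

fun mat_tr :: "mat2 \<Rightarrow> mat2" where
  "mat_tr (p, q, r, s) = (p, r, q, s)"

definition SL2Z :: "mat2 set" where
  "SL2Z = {A. mat_det A = 1}"

text \<open>Composition of the form with the linear map of the matrix, a right action. Nothing is
  divided by the determinant, so a scalar matrix \<open>d\<close> multiplies the form by
  \<open>d^2\<close>.\<close>

fun bqf_act :: "bqf \<Rightarrow> mat2 \<Rightarrow> bqf" where
  "bqf_act (a, b, c) (p, q, r, s) =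
     (a * p\<^sup>2 + b * p * r + c * r\<^sup>2,
      2 * a * p * q + b * (p * s + q * r) + 2 * c * r * s,
      a * q\<^sup>2 + b * q * s + c * s\<^sup>2)"

lemma mat_mul_assoc: "A \<cdot> B \<cdot> C = A \<cdot> (B \<cdot> C)"
  by (cases A; cases B; cases C) (simp add: algebra_simps)

lemma mat_det_mul: "mat_det (A \<cdot> B) = mat_det A * mat_det B"
  by (cases A; cases B) (simp add: algebra_simps)

lemma mat_one_mul [simp]: "(1, 0, 0, 1) \<cdot> A = A" "A \<cdot> (1, 0, 0, 1) = A"
  by (cases A; simp)+

lemma mat_tr_tr [simp]: "mat_tr (mat_tr A) = A"
  by (cases A) simp

lemma mat_tr_mul: "mat_tr (A \<cdot> B) = mat_tr B \<cdot> mat_tr A"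
  by (cases A; cases B) (simp add: algebra_simps)

lemma mat_det_tr [simp]: "mat_det (mat_tr A) = mat_det A"
  by (cases A) simp

lemma mat_adj_mul: "A \<cdot> mat_adj A = (mat_det A, 0, 0, mat_det A)"
    "mat_adj A \<cdot> A = (mat_det A, 0, 0, mat_det A)"
  by (cases A; simp add: algebra_simps)+

lemma mat_det_adj [simp]: "mat_det (mat_adj A) = mat_det A"
  by (cases A) (simp add: algebra_simps)

lemma SL2Z_mul: "A \<in> SL2Z \<Longrightarrow> B \<in> SL2Z \<Longrightarrow> A \<cdot> B \<in> SL2Z"
  by (simp add: SL2Z_def mat_det_mul)

lemma SL2Z_adj: "A \<in> SL2Z \<Longrightarrow> mat_adj A \<in> SL2Z"
  by (simp add: SL2Z_def)

lemma SL2Z_tr: "A \<in> SL2Z \<Longrightarrow> mat_tr A \<in> SL2Z"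
  by (simp add: SL2Z_def)

lemma SL2Z_cancel:
  assumes "A \<in> SL2Z"
  shows "mat_adj A \<cdot> (A \<cdot> B) = B" "A \<cdot> (mat_adj A \<cdot> B) = B"
    "B \<cdot> A \<cdot> mat_adj A = B" "B \<cdot> mat_adj A \<cdot> A = B"
  using assms by (simp_all add: SL2Z_def mat_mul_assoc [symmetric] mat_adj_mul)
    (simp_all add: mat_mul_assoc mat_adj_mul)

lemma mat_mul_right_cancel:
  assumes "mat_det C \<noteq> 0" "A \<cdot> C = B \<cdot> C"
  shows "A = B"
proof -
  have "A \<cdot> (C \<cdot> mat_adj C) = B \<cdot> (C \<cdot> mat_adj C)"
    using assms(2) by (simp add: mat_mul_assoc [symmetric])
  then show ?thesis
    using assms(1) by (cases A; cases B) (simp add: mat_adj_mul)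
qed

lemma bqf_act_mul: "bqf_act f (A \<cdot> B) = bqf_act (bqf_act f A) B"
  by (cases f; cases A; cases B) (simp add: power2_eq_square algebra_simps)

lemma bqf_act_one [simp]: "bqf_act f (1, 0, 0, 1) = f"
  by (cases f) simp

lemma bqf_act_cancel:
  assumes "A \<in> SL2Z"
  shows "bqf_act (bqf_act f A) (mat_adj A) = f" "bqf_act (bqf_act f (mat_adj A)) A = f"
  using assms by (simp_all add: bqf_act_mul [symmetric] mat_adj_mul SL2Z_def)

text \<open>Acting further by the adjugate amounts to acting by a scalar matrix, which multiplies
  every coefficient by the nonzero square of the determinant.\<close>

lemma bqf_act_inj:
  assumes "mat_det A \<noteq> 0" "bqf_act f A = bqf_act g A"
  shows "f = g"
proof -
  have "bqf_act f (A \<cdot> mat_adj A) = bqf_act g (A \<cdot> mat_adj A)"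
    using assms(2) by (simp add: bqf_act_mul)
  then show ?thesis
    using assms(1) by (cases f; cases g) (auto simp add: mat_adj_mul)
qed

lemma bqf_eval_act:
  "bqf_eval (bqf_act f (p, q, r, s)) x y = bqf_eval f (p * x + q * y) (r * x + s * y)"
  by (cases f) (simp add: power2_eq_square algebra_simps)

lemma bqf_disc_act: "bqf_disc (bqf_act f A) = (mat_det A)\<^sup>2 * bqf_disc f"
  by (cases f; cases A) (simp add: power2_eq_square algebra_simps)

text \<open>The values at \<open>(1, 0)\<close>, \<open>(0, 1)\<close> and \<open>(1, 1)\<close> are
  \<open>a\<close>, \<open>c\<close> and \<open>a + b + c\<close>.\<close>

lemma bqf_eqI:
  assumes "\<And>x y. bqf_eval f x y = bqf_eval g x y"
  shows "f = g"
  using assms [of 1 0] assms [of 0 1] assms [of 1 1] by (cases f; cases g) simp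

lemma bqf_equiv_iff: "bqf_equiv f g \<longleftrightarrow> (\<exists>A\<in>SL2Z. bqf_act f A = g)"
proof
  assume "bqf_equiv f g"
  then obtain p q r s where *: "p * s - q * r = 1"
      "\<And>x y. bqf_eval g x y = bqf_eval f (p * x + q * y) (r * x + s * y)"
    unfolding bqf_equiv_def by blast
  have "bqf_act f (p, q, r, s) = g"
    by (rule bqf_eqI) (simp add: bqf_eval_act *)
  moreover have "(p, q, r, s) \<in> SL2Z"
    using *(1) by (simp add: SL2Z_def)
  ultimately show "\<exists>A\<in>SL2Z. bqf_act f A = g" by blast
next
  assume "\<exists>A\<in>SL2Z. bqf_act f A = g"
  then obtain p q r s where "(p, q, r, s) \<in> SL2Z" "bqf_act f (p, q, r, s) = g"
    by auto
  then show "bqf_equiv f g"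
    unfolding bqf_equiv_def SL2Z_def
    by (intro exI [of _ p] exI [of _ q] exI [of _ r] exI [of _ s])
      (auto simp flip: bqf_eval_act)
qed

lemma bqf_equiv_refl: "bqf_equiv f f"
  unfolding bqf_equiv_iff by (rule bexI [of _ "(1, 0, 0, 1)"]) (auto simp: SL2Z_def)

lemma bqf_equiv_sym: "bqf_equiv f g \<Longrightarrow> bqf_equiv g f"
  unfolding bqf_equiv_iff using SL2Z_adj bqf_act_cancel by blast

lemma bqf_equiv_trans:
  assumes "bqf_equiv f g" "bqf_equiv g h"
  shows "bqf_equiv f h"
proof -
  obtain A B where "A \<in> SL2Z" "bqf_act f A = g" "B \<in> SL2Z" "bqf_act g B = h"
    using assms unfolding bqf_equiv_iff by blast
  then have "A \<cdot> B \<in> SL2Z" "bqf_act f (A \<cdot> B) = h"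
    by (simp_all add: SL2Z_mul bqf_act_mul)
  then show ?thesis unfolding bqf_equiv_iff by blast
qed

section \<open>Positive definite forms\<close>

lemma pos_forms_iff:
  assumes "D > 0"
  shows "(a, b, c) \<in> pos_forms D \<longleftrightarrow> a > 0 \<and> 4 * a * c = b\<^sup>2 + D"
proof
  assume "(a, b, c) \<in> pos_forms D"
  then have "bqf_pos_def (a, b, c)" "b\<^sup>2 - 4 * a * c = - D"
    by (auto simp: pos_forms_def)
  moreover from this(1) have "bqf_eval (a, b, c) 1 0 > 0"
    by (simp only: bqf_pos_def_def prod.inject simp_thms zero_neq_one one_neq_zero)
  ultimately show "a > 0 \<and> 4 * a * c = b\<^sup>2 + D" by simp
next
  assume *: "a > 0 \<and> 4 * a * c = b\<^sup>2 + D"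
  have "bqf_eval (a, b, c) x y > 0" if "(x, y) \<noteq> (0, 0)" for x y
  proof -
    \<comment> \<open>Completing the square leaves two nonnegative terms; the first is positive if
      \<open>y = 0\<close>, the second otherwise.\<close>
    have "4 * a * bqf_eval (a, b, c) x y = (2 * a * x + b * y)\<^sup>2 + (4 * a * c - b\<^sup>2) * y\<^sup>2"
      by (simp add: power2_eq_square algebra_simps)
    also have "\<dots> = (2 * a * x + b * y)\<^sup>2 + D * y\<^sup>2"
      using * by simp
    also have "\<dots> > 0"
    proof (cases "y = 0")
      case True
      then show ?thesis using that * by simp
    next
      case False
      then show ?thesis using assms by (intro add_nonneg_pos) simp_all
    qed
    finally show ?thesis using * by (simp add: zero_less_mult_iff)
  qed
  then show "(a, b, c) \<in> pos_forms D"
    using * by (auto simp: pos_forms_def bqf_pos_def_def)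
qed

lemma pos_forms_act:
  assumes "f \<in> pos_forms D" "mat_det A \<noteq> 0"
  shows "bqf_act f A \<in> pos_forms ((mat_det A)\<^sup>2 * D)"
proof -
  obtain p q r s where A: "A = (p, q, r, s)" by (cases A)
  have "bqf_eval (bqf_act f A) x y > 0" if "(x, y) \<noteq> (0, 0)" for x y
  proof -
    have "(p * x + q * y, r * x + s * y) \<noteq> (0, 0)"
    proof
      assume "(p * x + q * y, r * x + s * y) = (0, 0)"
      then have *: "p * x + q * y = 0" "r * x + s * y = 0" by auto
      \<comment> \<open>Cramer's rule: a matrix of nonzero determinant kills no nonzero
        vector.\<close>
      have "mat_det A * x = s * (p * x + q * y) - q * (r * x + s * y)"
           "mat_det A * y = p * (r * x + s * y) - r * (p * x + q * y)"
        by (simp_all add: A algebra_simps)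
      then show False using * assms(2) that by auto
    qed
    then show ?thesis
      using assms(1) unfolding A bqf_eval_act by (simp add: pos_forms_def bqf_pos_def_def)
  qed
  then show ?thesis
    using assms(1) by (auto simp: pos_forms_def bqf_pos_def_def bqf_disc_act)
qed

lemma pos_forms_SL2Z: "f \<in> pos_forms D \<Longrightarrow> A \<in> SL2Z \<Longrightarrow> bqf_act f A \<in> pos_forms D"
  using pos_forms_act [of f D A] by (simp add: SL2Z_def)

lemma pos_forms_equiv: "f \<in> pos_forms D \<Longrightarrow> bqf_equiv f g \<Longrightarrow> g \<in> pos_forms D"
  unfolding bqf_equiv_iff using pos_forms_SL2Z by blast

subsection \<open>Reduced forms and stabilizers\<close>

text \<open>No sign convention is imposed on the boundary, so a class may contain two reduced forms,
  such as \<open>(a, a, c)\<close> and \<open>(a, - a, c)\<close>.\<close>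

fun bqf_reduced :: "bqf \<Rightarrow> bool" where
  "bqf_reduced (a, b, c) \<longleftrightarrow> \<bar>b\<bar> \<le> a \<and> a \<le> c"

text \<open>Gauss reduction as a descent on \<open>a + |b|\<close>: a shift by one lowers
  \<open>|b|\<close> while \<open>|b| > a\<close>, and the swap of the variables replaces
  \<open>a\<close> by \<open>c\<close> when \<open>c < a\<close>.\<close>

lemma ex_reduced:
  assumes "D > 0" "f \<in> pos_forms D"
  shows "\<exists>g. bqf_equiv f g \<and> bqf_reduced g"
  using assms(2)
proof (induction "nat (fst f + \<bar>fst (snd f)\<bar>)" arbitrary: f rule: less_induct)
  case less
  obtain a b c where f: "f = (a, b, c)" by (cases f)
  have a: "a > 0" and d: "4 * a * c = b\<^sup>2 + D"
    using less.prems assms(1) by (auto simp: f pos_forms_iff)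
  have step: ?case
    if A: "A \<in> SL2Z" "bqf_act f A = (a', b', c')" and lt: "a' + \<bar>b'\<bar> < a + \<bar>b\<bar>" for A a' b' c'
  proof -
    have "(a', b', c') \<in> pos_forms D"
      using pos_forms_SL2Z [OF less.prems A(1)] A(2) by simp
    moreover from this have "a' > 0" using assms(1) pos_forms_iff by blast
    ultimately obtain g where "bqf_equiv (a', b', c') g" "bqf_reduced g"
      using less.hyps [of "(a', b', c')"] lt add_pos_nonneg [OF a abs_ge_zero [of b]] by (auto simp: f)
    moreover have "bqf_equiv f (a', b', c')"
      using A bqf_equiv_iff by blast
    ultimately show ?thesis using bqf_equiv_trans by blast
  qed
  consider "\<bar>b\<bar> \<le> a" "a \<le> c" | "b > a" | "b < - a" | "c < a" by linarith
  then show ?case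
  proof cases
    case 1
    then show ?thesis using bqf_equiv_refl [of f] by (auto simp: f)
  next
    case 2
    show ?thesis
      by (rule step [of "(1, -1, 0, 1)" a "b - 2 * a" "a - b + c"])
        (use 2 a in \<open>auto simp: SL2Z_def f\<close>)
  next
    case 3
    show ?thesis
      by (rule step [of "(1, 1, 0, 1)" a "b + 2 * a" "a + b + c"])
        (use 3 a in \<open>auto simp: SL2Z_def f\<close>)
  next
    case 4
    show ?thesis
      by (rule step [of "(0, -1, 1, 0)" c "- b" a])
        (use 4 in \<open>auto simp: SL2Z_def f\<close>)
  qed
qed

text \<open>For a reduced form \<open>D = 4 a c - b^2\<close> is at least
  \<open>4 a^2 - a^2\<close>.\<close>

lemma reduced_disc_ge:
  assumes "D > 0" "(a, b, c) \<in> pos_forms D" "bqf_reduced (a, b, c)"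
  shows "3 * a\<^sup>2 \<le> D"
proof -
  have "a > 0" "4 * a * c = b\<^sup>2 + D" "\<bar>b\<bar> \<le> a" "a \<le> c"
    using assms by (auto simp: pos_forms_iff)
  moreover have "b\<^sup>2 \<le> a\<^sup>2" using \<open>\<bar>b\<bar> \<le> a\<close> abs_le_square_iff [of b a] by simp
  moreover have "a\<^sup>2 \<le> a * c" using \<open>a > 0\<close> \<open>a \<le> c\<close> by (simp add: power2_eq_square)
  ultimately show ?thesis by linarith
qed

text \<open>The bound \<open>3 a^2 \<le> D\<close> leaves finitely many \<open>a\<close> and
  \<open>b\<close>, and the discriminant then fixes \<open>c\<close>.\<close>

lemma finite_reduced:
  assumes "D > 0"
  shows "finite {f \<in> pos_forms D. bqf_reduced f}"
proof (rule finite_subset)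
  show "finite ((\<lambda>(a, b). (a, b, (b\<^sup>2 + D) div (4 * a))) ` ({1..D} \<times> {- D..D}))" by simp
  show "{f \<in> pos_forms D. bqf_reduced f} \<subseteq>
    (\<lambda>(a, b). (a, b, (b\<^sup>2 + D) div (4 * a))) ` ({1..D} \<times> {- D..D})"
  proof clarify
    fix a b c assume *: "(a, b, c) \<in> pos_forms D" "bqf_reduced (a, b, c)"
    then have **: "a > 0" "4 * a * c = b\<^sup>2 + D" using assms by (auto simp: pos_forms_iff)
    have "a * 1 \<le> a\<^sup>2" using **(1) unfolding power2_eq_square by (intro mult_left_mono) auto
    then have "a \<le> D"
      using reduced_disc_ge [OF assms *] **(1) by linarith
    moreover have "c = (b\<^sup>2 + D) div (4 * a)"
      unfolding **(2) [symmetric] using **(1) by simp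
    ultimately show "(a, b, c) \<in> (\<lambda>(a, b). (a, b, (b\<^sup>2 + D) div (4 * a))) ` ({1..D} \<times> {- D..D})"
      using **(1) *(2) by (intro image_eqI [of _ _ "(a, b)"]) auto
  qed
qed

section \<open>Transporters and automorphs\<close>

definition transporter :: "bqf \<Rightarrow> bqf \<Rightarrow> mat2 set" where
  "transporter f g = {A \<in> SL2Z. bqf_act f A = g}"

abbreviation bqf_stab :: "bqf \<Rightarrow> mat2 set" where
  "bqf_stab f \<equiv> transporter f f"

lemma transporter_mul: "A \<in> transporter f g \<Longrightarrow> B \<in> transporter g h \<Longrightarrow> A \<cdot> B \<in> transporter f h"
  by (simp add: transporter_def bqf_act_mul SL2Z_mul)

lemma transporter_adj: "A \<in> transporter f g \<Longrightarrow> mat_adj A \<in> transporter g f"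
  using bqf_act_cancel SL2Z_adj unfolding transporter_def by blast

text \<open>Any element of the transporter identifies it, by multiplication, with the stabilizer of
  \<open>f\<close> on one side and with that of \<open>g\<close> on the other.\<close>

lemma card_transporter:
  assumes "bqf_equiv f g"
  shows "card (transporter f g) = card (bqf_stab f)" "card (transporter f g) = card (bqf_stab g)"
proof -
  obtain A where A: "A \<in> transporter f g"
    using assms unfolding bqf_equiv_iff transporter_def by blast
  then have "A \<in> SL2Z" by (simp add: transporter_def)
  note cancel = SL2Z_cancel [OF this]
  have "bij_betw (\<lambda>C. C \<cdot> A) (bqf_stab f) (transporter f g)"
    by (rule bij_betw_byWitness [where f' = "\<lambda>C. C \<cdot> mat_adj A"])
      (use A transporter_mul transporter_adj cancel in blast)+
  moreover have "bij_betw (\<lambda>C. A \<cdot> C) (bqf_stab g) (transporter f g)"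
    by (rule bij_betw_byWitness [where f' = "\<lambda>C. mat_adj A \<cdot> C"])
      (use A transporter_mul transporter_adj cancel in blast)+
  ultimately show "card (transporter f g) = card (bqf_stab f)"
    "card (transporter f g) = card (bqf_stab g)"
    by (auto dest: bij_betw_same_card)
qed

lemma transporter_empty: "\<not> bqf_equiv f g \<Longrightarrow> transporter f g = {}"
  unfolding transporter_def bqf_equiv_iff by blast

lemma bqf_stab_equations:
  assumes "(p, q, r, s) \<in> bqf_stab (a, b, c)"
  shows "p * s - q * r = 1" "a * (s - p) = b * r" "a * q = - (c * r)"
proof -
  let ?f = "(a, b, c)" and ?A = "(p, q, r, s)"
  show det: "p * s - q * r = 1" using assms by (simp add: transporter_def SL2Z_def)
  from assms have 1: "a * p\<^sup>2 + b * p * r + c * r\<^sup>2 = a"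
    and 2: "2 * a * p * q + b * (p * s + q * r) + 2 * c * r * s = b"
    by (auto simp: transporter_def)
  \<comment> \<open>\<open>(?U, ?V)\<close> is the Hessian of the form applied to the first column
    of the automorph. Invariance says that the transposed automorph sends it to
    \<open>(2 * a, b)\<close>; inverting this makes the conditions linear in the entries.\<close>
  let ?U = "2 * a * p + b * r" and ?V = "b * p + 2 * c * r"
  have *: "p * ?U + r * ?V = 2 * a" "q * ?U + s * ?V = b"
    using 1 2 by (simp_all add: power2_eq_square algebra_simps)
  have "?U * (p * s - q * r) = s * (p * ?U + r * ?V) - r * (q * ?U + s * ?V)"
       "?V * (p * s - q * r) = p * (q * ?U + s * ?V) - q * (p * ?U + r * ?V)"
    by (simp_all add: algebra_simps)
  then show "a * (s - p) = b * r" "a * q = - (c * r)"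
    unfolding det * by (simp_all add: algebra_simps)
qed

text \<open>The linear equations force \<open>s = p\<close> and \<open>q = - r\<close>, so
  automorphs correspond to solutions of \<open>p^2 + r^2 = 1\<close>, the four units of the Gaussian
  integers.\<close>

lemma card_bqf_stab_square:
  assumes "k > 0"
  shows "card (bqf_stab (k, 0, k)) = 4"
proof -
  have "bqf_stab (k, 0, k) = {(1,0,0,1), (-1,0,0,-1), (0,-1,1,0), (0,1,-1,0)}" (is "_ = ?R")
  proof
    show "bqf_stab (k, 0, k) \<subseteq> ?R"
    proof
      fix A assume A: "A \<in> bqf_stab (k, 0, k)"
      obtain p q r s where pqrs: "A = (p, q, r, s)" by (cases A)
      then have "(p, q, r, s) \<in> bqf_stab (k, 0, k)" using A by simp
      from bqf_stab_equations [OF this] assms have "p * s - q * r = 1" "s = p" "k * (q + r) = 0"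
        by (auto simp: algebra_simps)
      moreover from this have "q = - r" using assms by auto
      ultimately have *: "s = p" "q = - r" "p\<^sup>2 + r\<^sup>2 = 1"
        by (simp_all add: power2_eq_square)
      have "p\<^sup>2 \<le> 1" "r\<^sup>2 \<le> 1" using *(3) zero_le_power2 [of p] zero_le_power2 [of r] by linarith+
      then have "\<bar>p\<bar> \<le> 1" "\<bar>r\<bar> \<le> 1" by (simp_all add: abs_square_le_1)
      then have "p \<in> {-1,0,1}" "r \<in> {-1,0,1}" by auto
      then show "A \<in> ?R" using * pqrs by auto
    qed
    show "?R \<subseteq> bqf_stab (k, 0, k)" by (auto simp: transporter_def SL2Z_def)
  qed
  then show ?thesis by simp
qed

text \<open>Here \<open>s = p + r\<close> and \<open>q = - r\<close>, so automorphs correspond to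
  solutions of \<open>p^2 + p r + r^2 = 1\<close>, the six units of the Eisenstein integers.\<close>

lemma card_bqf_stab_hexagonal:
  assumes "k > 0"
  shows "card (bqf_stab (k, k, k)) = 6"
proof -
  have "bqf_stab (k, k, k) =
    {(1,0,0,1), (-1,0,0,-1), (0,-1,1,1), (0,1,-1,-1), (1,1,-1,0), (-1,-1,1,0)}" (is "_ = ?R")
  proof
    show "bqf_stab (k, k, k) \<subseteq> ?R"
    proof
      fix A assume A: "A \<in> bqf_stab (k, k, k)"
      obtain p q r s where pqrs: "A = (p, q, r, s)" by (cases A)
      then have "(p, q, r, s) \<in> bqf_stab (k, k, k)" using A by simp
      note eqs = bqf_stab_equations [OF this]
      have s: "s = p + r" using eqs(2) assms by simp
      have "k * q = k * (- r)" using eqs(3) by simp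
      then have q: "q = - r" using assms by (simp only: mult_cancel_left) simp
      have one: "p\<^sup>2 + p * r + r\<^sup>2 = 1"
        using eqs(1) unfolding s q by (simp add: power2_eq_square algebra_simps)
      have "4 * (p\<^sup>2 + p * r + r\<^sup>2) = (2 * p + r)\<^sup>2 + 3 * r\<^sup>2"
        "4 * (p\<^sup>2 + p * r + r\<^sup>2) = (2 * r + p)\<^sup>2 + 3 * p\<^sup>2"
        by (simp_all add: power2_eq_square algebra_simps)
      then have "p\<^sup>2 \<le> 1" "r\<^sup>2 \<le> 1"
        unfolding one using zero_le_power2 [of "2 * p + r"] zero_le_power2 [of "2 * r + p"]
        by linarith+
      then have "\<bar>p\<bar> \<le> 1" "\<bar>r\<bar> \<le> 1" by (simp_all add: abs_square_le_1)
      then have "p = -1 \<or> p = 0 \<or> p = 1" "r = -1 \<or> r = 0 \<or> r = 1" by linarith+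
      then have "(p, r) \<in> {(1,0), (-1,0), (0,1), (0,-1), (1,-1), (-1,1)}"
        using one by (elim disjE) simp_all
      then show "A \<in> ?R" by (elim insertE emptyE) (simp_all add: pqrs s q)
    qed
    show "?R \<subseteq> bqf_stab (k, k, k)" by (auto simp: transporter_def SL2Z_def)
  qed
  then show ?thesis by simp
qed

text \<open>For an automorphism with trace \<open>t\<close> and lower left entry \<open>r\<close> one has
  \<open>a\<^sup>2 (4 - t\<^sup>2) = D r\<^sup>2\<close>, and \<open>D \<ge> 3 a\<^sup>2\<close> for a reduced form.\<close>

lemma reduced_stab_cases:
  assumes D: "D > 0" and f: "(a, b, c) \<in> pos_forms D" "bqf_reduced (a, b, c)"
    and A: "(p, q, r, s) \<in> bqf_stab (a, b, c)" and r: "r \<noteq> 0"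
  shows "(b = 0 \<or> b = a \<or> b = - a) \<and> c = a"
proof -
  have a: "a > 0" and d: "4 * a * c = b\<^sup>2 + D" and red: "\<bar>b\<bar> \<le> a" "a \<le> c"
    using D f by (auto simp: pos_forms_iff)
  note eqs = bqf_stab_equations [OF A]
  define t where "t = p + s"
  have "a\<^sup>2 * (4 - t\<^sup>2) = 4 * a\<^sup>2 * (p * s - q * r) - a\<^sup>2 * t\<^sup>2"
    using eqs(1) by (simp add: algebra_simps)
  also have "\<dots> = - ((a * (s - p))\<^sup>2) - 4 * a * (a * q) * r"
    by (simp add: t_def power2_eq_square algebra_simps)
  also have "\<dots> = (4 * a * c - b\<^sup>2) * r\<^sup>2"
    unfolding eqs by (simp add: power2_eq_square algebra_simps)
  finally have "a\<^sup>2 * (4 - t\<^sup>2) = D * r\<^sup>2" using d by simp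
  moreover have "3 * a\<^sup>2 * r\<^sup>2 \<le> D * r\<^sup>2"
    using reduced_disc_ge [OF D f] by (simp add: mult_right_mono)
  ultimately have "a\<^sup>2 * (3 * r\<^sup>2) \<le> a\<^sup>2 * (4 - t\<^sup>2)" by (simp add: algebra_simps)
  then have le: "3 * r\<^sup>2 \<le> 4 - t\<^sup>2" using a by simp
  have r1: "r\<^sup>2 \<ge> 1" using r by (simp add: int_one_le_iff_zero_less)
  have "r\<^sup>2 \<le> 1" "t\<^sup>2 \<le> 1" using le zero_le_power2 [of t] r1 by linarith+
  then have r2: "r\<^sup>2 = 1" using r1 by simp
  have "\<bar>t\<bar> \<le> 1" using \<open>t\<^sup>2 \<le> 1\<close> by (simp add: abs_square_le_1)
  have ra: "\<bar>r\<bar> = 1" using r2 by (auto simp: power2_eq_1_iff)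
  have "a * \<bar>s - p\<bar> = \<bar>b\<bar>"
    using arg_cong [OF eqs(2), of abs] a ra by (simp add: abs_mult)
  then have "a * \<bar>s - p\<bar> \<le> a * 1" using red by simp
  then have "\<bar>s - p\<bar> \<le> 1" using a by simp
  then have "s - p = 0 \<or> s - p = 1 \<or> s - p = -1" by linarith
  then have b: "b = 0 \<or> b = a \<or> b = - a"
    using \<open>a * \<bar>s - p\<bar> = \<bar>b\<bar>\<close> by (auto simp: abs_if split: if_splits)
  have D': "D = a\<^sup>2 * (4 - t\<^sup>2)" using \<open>a\<^sup>2 * (4 - t\<^sup>2) = D * r\<^sup>2\<close> r2 by simp
  have b2: "b\<^sup>2 = a\<^sup>2 * (s - p)\<^sup>2" using eqs(2) r2 by (metis mult_1_right power_mult_distrib)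
  \<comment> \<open>\<open>t\<close> and \<open>s - p\<close> have the same parity and absolute
    value at most 1, hence equal squares. Then \<open>D + b^2 = 4 a^2\<close>, which forces
    \<open>c = a\<close>.\<close>
  have "t = s - p + 2 * p" by (simp add: t_def)
  then have "(s - p)\<^sup>2 = t\<^sup>2"
    using \<open>\<bar>t\<bar> \<le> 1\<close> \<open>s - p = 0 \<or> s - p = 1 \<or> s - p = -1\<close>
    by (smt (verit) power2_minus power2_eq_1_iff)
  then have "4 * a * c = 4 * a * a" using d D' b2 by (simp add: power2_eq_square algebra_simps)
  then show ?thesis using a b by simp
qed

text \<open>An automorph with nonzero lower left entry forces one of the two special shapes,
  \<open>(a, - a, a)\<close> being a shift of \<open>(a, a, a)\<close>. If all automorphs are upper
  triangular, only plus and minus the identity remain.\<close>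

lemma card_bqf_stab_reduced:
  assumes D: "D > 0" and f: "f \<in> pos_forms D" "bqf_reduced f"
  shows "card (bqf_stab f) = 2 \<or> (\<exists>k>0. bqf_equiv f (k, 0, k) \<or> bqf_equiv f (k, k, k))"
proof (cases "\<exists>p q r s. (p, q, r, s) \<in> bqf_stab f \<and> r \<noteq> 0")
  case True
  obtain a b c where abc: "f = (a, b, c)" by (cases f)
  from True have "(b = 0 \<or> b = a \<or> b = - a) \<and> c = a"
    using reduced_stab_cases [OF D] f unfolding abc by blast
  moreover have "a > 0" using f D by (auto simp: abc pos_forms_iff)
  moreover have "bqf_equiv (a, - a, a) (a, a, a)"
    unfolding bqf_equiv_iff by (rule bexI [of _ "(1, 1, 0, 1)"]) (auto simp: SL2Z_def)
  ultimately show ?thesis using bqf_equiv_refl by (auto simp: abc)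
next
  case False
  obtain a b c where abc: "f = (a, b, c)" by (cases f)
  have a: "a > 0" using f D by (auto simp: abc pos_forms_iff)
  have "bqf_stab f = {(1,0,0,1), (-1,0,0,-1)}"
  proof
    show "bqf_stab f \<subseteq> {(1,0,0,1), (-1,0,0,-1)}"
    proof
      fix A assume A: "A \<in> bqf_stab f"
      obtain p q r s where pqrs: "A = (p, q, r, s)" by (cases A)
      note * = A [unfolded pqrs]
      have "r = 0" using False * by blast
      with bqf_stab_equations [OF * [unfolded abc]] a
      have "s = p" "q = 0" "r = 0" "p * p = 1" by auto
      then show "A \<in> {(1,0,0,1), (-1,0,0,-1)}" by (auto simp: pqrs zmult_eq_1_iff)
    qed
    show "{(1,0,0,1), (-1,0,0,-1)} \<subseteq> bqf_stab f"
      by (auto simp: transporter_def SL2Z_def abc)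
  qed
  then show ?thesis by simp
qed

lemma card_bqf_stab_equiv: "bqf_equiv f g \<Longrightarrow> card (bqf_stab f) = card (bqf_stab g)"
  using card_transporter by metis

text \<open>The three cases are those of \<open>class_weight\<close>, tested in the same order, and
  each value is 2 divided by the corresponding weight.\<close>

lemma card_bqf_stab:
  assumes D: "D > 0" and f: "f \<in> pos_forms D"
  shows "card (bqf_stab f) =
    (if \<exists>k. bqf_equiv f (k, 0, k) then 4 else if \<exists>k. bqf_equiv f (k, k, k) then 6 else 2)"
proof -
  obtain g where g: "bqf_equiv f g" "bqf_reduced g" using ex_reduced [OF D f] by blast
  have g': "g \<in> pos_forms D" using pos_forms_equiv f g by blast
  have pos: "k > 0" if "bqf_equiv f (k, 0, k) \<or> bqf_equiv f (k, k, k)" for k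
    using that pos_forms_equiv [OF f] pos_forms_iff [OF D] by blast
  have sq: "card (bqf_stab f) = 4" if "bqf_equiv f (k, 0, k)" for k
    using card_bqf_stab_equiv [OF that] card_bqf_stab_square [of k] pos [of k] that by simp
  have hx: "card (bqf_stab f) = 6" if "bqf_equiv f (k, k, k)" for k
    using card_bqf_stab_equiv [OF that] card_bqf_stab_hexagonal [of k] pos [of k] that by simp
  have "card (bqf_stab f) = 2"
    if "\<nexists>k. bqf_equiv f (k, 0, k)" "\<nexists>k. bqf_equiv f (k, k, k)"
    using that card_bqf_stab_reduced [OF D g' g(2)] card_bqf_stab_equiv [OF g(1)]
      bqf_equiv_trans [OF g(1)] by metis
  with sq hx show ?thesis by auto
qed

subsection \<open>Systems of representatives\<close>

text \<open>An arbitrary transversal rather than a list of reduced forms: this lets a transversal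
  for \<open>l^2 D\<close> induce one for \<open>D\<close> through its members divisible by
  \<open>l\<close>.\<close>

definition rep_system :: "int \<Rightarrow> bqf set \<Rightarrow> bool" where
  "rep_system D R \<longleftrightarrow> R \<subseteq> pos_forms D \<and> (\<forall>f\<in>pos_forms D. \<exists>!g. g \<in> R \<and> bqf_equiv f g)"

lemma rep_systemD:
  assumes "rep_system D R"
  shows "g \<in> R \<Longrightarrow> g \<in> pos_forms D" "f \<in> pos_forms D \<Longrightarrow> \<exists>!g. g \<in> R \<and> bqf_equiv f g"
  using assms by (auto simp: rep_system_def)

lemma rep_system_unique:
  assumes "rep_system D R" "f \<in> R" "g \<in> R" "bqf_equiv f g"
  shows "f = g"
  using rep_systemD [OF assms(1)] assms(2-4) bqf_equiv_refl by blast

text \<open>A representative chosen from the predicate \<open>bqf_equiv f\<close> is constant on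
  classes, because equivalent forms have the same predicate.\<close>

lemma ex_rep_system: "\<exists>R. rep_system D R"
proof -
  define r where "r f = (SOME g. bqf_equiv f g)" for f
  have r: "bqf_equiv f (r f)" for f
    unfolding r_def by (rule someI) (rule bqf_equiv_refl)
  have r_cong: "r f = r g" if "bqf_equiv f g" for f g
  proof -
    have "bqf_equiv f = bqf_equiv g"
      using that bqf_equiv_sym bqf_equiv_trans by blast
    then show ?thesis by (simp add: r_def)
  qed
  have "rep_system D (r ` pos_forms D)"
    unfolding rep_system_def
  proof (intro conjI ballI)
    show "r ` pos_forms D \<subseteq> pos_forms D" using r pos_forms_equiv by blast
    fix f assume f: "f \<in> pos_forms D"
    show "\<exists>!g. g \<in> r ` pos_forms D \<and> bqf_equiv f g"
    proof (rule ex1I [of _ "r f"])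
      show "r f \<in> r ` pos_forms D \<and> bqf_equiv f (r f)" using f r by blast
      fix g assume "g \<in> r ` pos_forms D \<and> bqf_equiv f g"
      then obtain h where h: "g = r h" "bqf_equiv f (r h)" by blast
      then have "bqf_equiv f h" using r bqf_equiv_sym bqf_equiv_trans by blast
      then show "g = r f" using r_cong h by simp
    qed
  qed
  then show ?thesis by blast
qed

text \<open>Sending each representative to a reduced form in its class is injective.\<close>

lemma finite_rep_system:
  assumes D: "D > 0" and R: "rep_system D R"
  shows "finite R"
proof -
  have "\<forall>f\<in>R. \<exists>g. bqf_equiv f g \<and> bqf_reduced g"
    using ex_reduced [OF D] rep_systemD(1) [OF R] by blast
  then obtain h where h: "\<And>f. f \<in> R \<Longrightarrow> bqf_equiv f (h f) \<and> bqf_reduced (h f)" by metis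
  have "inj_on h R"
  proof (rule inj_onI)
    fix f g assume fg: "f \<in> R" "g \<in> R" "h f = h g"
    then have "bqf_equiv f (h f)" "bqf_equiv g (h f)" using h [of f] h [of g] by simp_all
    then have "bqf_equiv f g" using bqf_equiv_sym bqf_equiv_trans by blast
    then show "f = g" using rep_system_unique [OF R] fg by blast
  qed
  moreover have "h ` R \<subseteq> {f \<in> pos_forms D. bqf_reduced f}"
    using h pos_forms_equiv rep_systemD(1) [OF R] by blast
  ultimately show ?thesis
    using finite_reduced [OF D] finite_imageD finite_subset by blast
qed

text \<open>Classes correspond to members of \<open>R\<close>, and the weight of a class is 2 over
  the order of the stabilizer. Stabilizers are what the double count below handles.\<close>

lemma hurwitz_class_number_eq:
  assumes D: "D > 0" and R: "rep_system D R"
  shows "hurwitz_class_number D = 2 * (\<Sum>f\<in>R. 1 / of_nat (card (bqf_stab f)))"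
proof -
  define E where "E = {(f, g). f \<in> pos_forms D \<and> g \<in> pos_forms D \<and> bqf_equiv f g}"
  define cls where "cls f = {g. bqf_equiv f g}" for f
  have E: "E `` {f} = cls f" if "f \<in> pos_forms D" for f
    using that pos_forms_equiv [OF that] unfolding E_def cls_def by blast
  have cls_eq: "cls f = cls g" if "bqf_equiv f g" for f g
    using that bqf_equiv_sym bqf_equiv_trans unfolding cls_def by blast
  have "form_classes D = cls ` R"
  proof -
    have "form_classes D = cls ` pos_forms D"
      unfolding form_classes_def quotient_def E_def [symmetric] using E by auto
    also have "\<dots> = cls ` R"
    proof
      show "cls ` pos_forms D \<subseteq> cls ` R"
      proof clarify
        fix f assume "f \<in> pos_forms D"
        then obtain g where "g \<in> R" "bqf_equiv f g" using rep_systemD(2) [OF R] by blast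
        then show "cls f \<in> cls ` R" using cls_eq by blast
      qed
      show "cls ` R \<subseteq> cls ` pos_forms D" using rep_systemD(1) [OF R] by blast
    qed
    finally show ?thesis .
  qed
  moreover have "inj_on cls R"
  proof (rule inj_onI)
    fix f g assume "f \<in> R" "g \<in> R" "cls f = cls g"
    then show "f = g"
      using rep_system_unique [OF R] bqf_equiv_refl [of g] unfolding cls_def by blast
  qed
  moreover have "class_weight (cls f) = 2 / of_nat (card (bqf_stab f))" if "f \<in> R" for f
    using card_bqf_stab [OF D rep_systemD(1) [OF R that]]
    by (auto simp: class_weight_def cls_def)
  ultimately show ?thesis
    using D by (simp add: hurwitz_class_number_def sum.reindex sum_distrib_left)
qed

section \<open>Multiples of forms\<close>

fun bqf_scale :: "int \<Rightarrow> bqf \<Rightarrow> bqf" where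
  "bqf_scale k (a, b, c) = (k * a, k * b, k * c)"

lemma bqf_scale_inj: "k \<noteq> 0 \<Longrightarrow> bqf_scale k f = bqf_scale k g \<longleftrightarrow> f = g"
  by (cases f; cases g) simp

lemma bqf_act_scale: "bqf_act (bqf_scale k f) A = bqf_scale k (bqf_act f A)"
  by (cases f; cases A) (simp add: algebra_simps)

lemma transporter_scale: "k \<noteq> 0 \<Longrightarrow> transporter (bqf_scale k f) (bqf_scale k g) = transporter f g"
  by (simp add: transporter_def bqf_act_scale bqf_scale_inj)

lemma bqf_equiv_scale: "k \<noteq> 0 \<Longrightarrow> bqf_equiv (bqf_scale k f) (bqf_scale k g) \<longleftrightarrow> bqf_equiv f g"
  by (simp add: bqf_equiv_iff bqf_act_scale bqf_scale_inj)

lemma pos_forms_scale: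
  assumes "k > 0"
  shows "bqf_scale k f \<in> pos_forms (k\<^sup>2 * D) \<longleftrightarrow> f \<in> pos_forms D"
proof -
  have "bqf_eval (bqf_scale k f) x y = k * bqf_eval f x y" for x y
    by (cases f) (simp add: algebra_simps)
  moreover have "bqf_disc (bqf_scale k f) = k\<^sup>2 * bqf_disc f"
    by (cases f) (simp add: power2_eq_square algebra_simps)
  ultimately show ?thesis
    using assms by (auto simp: pos_forms_def bqf_pos_def_def zero_less_mult_iff)
      (metis mult_cancel_left mult_minus_right power_not_zero less_irrefl)
qed

text \<open>Scaling commutes with the action, so whatever is equivalent to a multiple of
  \<open>k\<close> is again a multiple of \<open>k\<close>.\<close>

lemma rep_system_unscale:
  assumes k: "k > 0" and S: "rep_system (k\<^sup>2 * D) S"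
  shows "rep_system D {f. bqf_scale k f \<in> S}"
  unfolding rep_system_def
proof (intro conjI ballI)
  show "{f. bqf_scale k f \<in> S} \<subseteq> pos_forms D"
    using rep_systemD(1) [OF S] pos_forms_scale [OF k] by blast
  fix f assume "f \<in> pos_forms D"
  then have "bqf_scale k f \<in> pos_forms (k\<^sup>2 * D)" using pos_forms_scale [OF k] by blast
  from rep_systemD(2) [OF S this]
  obtain h where h: "h \<in> S" "bqf_equiv (bqf_scale k f) h"
    and uniq: "\<And>h'. h' \<in> S \<Longrightarrow> bqf_equiv (bqf_scale k f) h' \<Longrightarrow> h' = h" by blast
  from h(2) obtain A where "bqf_act (bqf_scale k f) A = h" unfolding bqf_equiv_iff by blast
  then have hA: "h = bqf_scale k (bqf_act f A)" by (simp add: bqf_act_scale)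
  show "\<exists>!g. g \<in> {f. bqf_scale k f \<in> S} \<and> bqf_equiv f g"
  proof (rule ex1I [of _ "bqf_act f A"])
    show "bqf_act f A \<in> {f. bqf_scale k f \<in> S} \<and> bqf_equiv f (bqf_act f A)"
      using h k by (simp add: hA bqf_equiv_scale)
    fix g assume "g \<in> {f. bqf_scale k f \<in> S} \<and> bqf_equiv f g"
    then have "bqf_scale k g = h" using uniq k by (simp add: bqf_equiv_scale)
    then show "g = bqf_act f A" using k by (simp add: hA bqf_scale_inj)
  qed
qed

text \<open>Acting by the adjugate turns the given form into \<open>d^2\<close> times
  \<open>f\<close>, with \<open>d\<close> the determinant, and the factor can be cancelled.\<close>

lemma pos_forms_of_act:
  assumes "bqf_act f A \<in> pos_forms ((mat_det A)\<^sup>2 * D)" and d: "mat_det A \<noteq> 0"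
  shows "f \<in> pos_forms D"
proof -
  let ?d = "mat_det A"
  have "bqf_act f (?d, 0, 0, ?d) \<in> pos_forms (?d\<^sup>2 * (?d\<^sup>2 * D))"
    using pos_forms_act [OF assms(1), of "mat_adj A"] d
    by (simp add: bqf_act_mul [symmetric] mat_adj_mul)
  moreover have "bqf_act f (?d, 0, 0, ?d) = bqf_scale (?d\<^sup>2) f"
    by (cases f) (simp add: power2_eq_square)
  ultimately have "bqf_scale (?d\<^sup>2) f \<in> pos_forms ((?d\<^sup>2)\<^sup>2 * D)"
    by (simp add: power2_eq_square mult.assoc)
  then show ?thesis using pos_forms_scale [of "?d\<^sup>2"] d by simp
qed

subsection \<open>Matrices of prime determinant\<close>

text \<open>One matrix for each point of the projective line over the integers modulo
  \<open>l\<close>, namely its kernel modulo \<open>l\<close>: \<open>(1, 0)\<close> for the first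
  matrix and \<open>(t, 1)\<close> for the others.\<close>

definition hermite_reps :: "int \<Rightarrow> mat2 set" where
  "hermite_reps l = insert (l, 0, 0, 1) ((\<lambda>t. (1, - t, 0, l)) ` {0..<l})"

lemma finite_hermite_reps [simp]: "finite (hermite_reps l)"
  by (simp add: hermite_reps_def)

lemma card_hermite_reps: "l > 1 \<Longrightarrow> card (hermite_reps l) = nat l + 1"
  by (subst hermite_reps_def, subst card_insert_disjoint)
    (auto simp: card_image inj_on_def)

lemma mat_det_hermite: "B \<in> hermite_reps l \<Longrightarrow> mat_det B = l"
  by (auto simp: hermite_reps_def)

lemma bqf_act_hermite_inj:
  "l \<noteq> 0 \<Longrightarrow> B \<in> hermite_reps l \<Longrightarrow> bqf_act f B = bqf_act g B \<longleftrightarrow> f = g"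
  using bqf_act_inj mat_det_hermite by blast

lemma ex1_root_mod_prime:
  fixes l p q :: int
  assumes "prime l" "\<not> l dvd p"
  shows "\<exists>!t. t \<in> {0..<l} \<and> l dvd p * t + q"
proof -
  have l: "l > 1" using assms(1) prime_gt_1_int by blast
  have "coprime p l" using assms by (simp add: prime_imp_coprime coprime_commute)
  then obtain v where v: "[p * v = 1] (mod l)" using cong_solve_coprime_int by blast
  show ?thesis
  proof (rule ex1I [of _ "(- q * v) mod l"])
    have "[p * ((- q * v) mod l) + q = p * (- q * v) + q] (mod l)"
      by (intro cong_add cong_mult cong_refl) (simp add: cong_def)
    moreover have "p * (- q * v) + q = - q * (p * v - 1)" by (simp add: algebra_simps)
    moreover have "l dvd p * v - 1" using v by (simp add: cong_iff_dvd_diff)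
    ultimately show "(- q * v) mod l \<in> {0..<l} \<and> l dvd p * ((- q * v) mod l) + q"
      using l by (simp add: cong_dvd_iff)
    fix t assume t: "t \<in> {0..<l} \<and> l dvd p * t + q"
    have "l dvd v * (p * t + q) - t * (p * v - 1)"
      using dvd_diff [OF dvd_mult dvd_mult] t \<open>l dvd p * v - 1\<close> by blast
    also have "v * (p * t + q) - t * (p * v - 1) = t - (- q * v)" by (simp add: algebra_simps)
    finally have "t mod l = (- q * v) mod l" by (simp add: mod_eq_dvd_iff)
    then show "t = (- q * v) mod l" using t by simp
  qed
qed

text \<open>The right-hand side says that the matrix kills \<open>(t, 1)\<close> modulo
  \<open>l\<close>, which is exactly when its quotient by the Hermite matrix is integral.\<close>

lemma left_coset_shear:
  assumes l: "l \<noteq> 0" and A: "mat_det (p, q, r, s) = l"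
  shows "(\<exists>C\<in>SL2Z. (p, q, r, s) = C \<cdot> (1, - t, 0, l)) \<longleftrightarrow> l dvd p * t + q \<and> l dvd r * t + s"
proof
  assume "\<exists>C\<in>SL2Z. (p, q, r, s) = C \<cdot> (1, - t, 0, l)"
  then obtain p' q' r' s' where "(p, q, r, s) = (p', q', r', s') \<cdot> (1, - t, 0, l)" by force
  then show "l dvd p * t + q \<and> l dvd r * t + s" by simp
next
  assume "l dvd p * t + q \<and> l dvd r * t + s"
  then obtain x y where xy: "p * t + q = l * x" "r * t + s = l * y" by (auto simp: dvd_def)
  have "l * (p * y - x * r) = p * (r * t + s) - r * (p * t + q)"
    unfolding xy by (simp add: algebra_simps)
  also have "\<dots> = l * 1" using A by (simp add: algebra_simps)
  finally have "(p, x, r, y) \<in> SL2Z" using l by (simp add: SL2Z_def)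
  moreover have "(p, q, r, s) = (p, x, r, y) \<cdot> (1, - t, 0, l)"
    using xy by (simp add: algebra_simps)
  ultimately show "\<exists>C\<in>SL2Z. (p, q, r, s) = C \<cdot> (1, - t, 0, l)" by blast
qed

lemma left_coset_diag:
  assumes l: "l \<noteq> 0" and A: "mat_det (p, q, r, s) = l"
  shows "(\<exists>C\<in>SL2Z. (p, q, r, s) = C \<cdot> (l, 0, 0, 1)) \<longleftrightarrow> l dvd p \<and> l dvd r"
proof
  assume "\<exists>C\<in>SL2Z. (p, q, r, s) = C \<cdot> (l, 0, 0, 1)"
  then obtain p' q' r' s' where "(p, q, r, s) = (p', q', r', s') \<cdot> (l, 0, 0, 1)" by force
  then show "l dvd p \<and> l dvd r" by simp
next
  assume "l dvd p \<and> l dvd r"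
  then obtain x y where xy: "p = l * x" "r = l * y" by (auto simp: dvd_def)
  have "l * (x * s - q * y) = l * 1" using A by (simp add: xy algebra_simps)
  then have "(x, q, y, s) \<in> SL2Z" using l by (simp add: SL2Z_def)
  moreover have "(p, q, r, s) = (x, q, y, s) \<cdot> (l, 0, 0, 1)" using xy by simp
  ultimately show "\<exists>C\<in>SL2Z. (p, q, r, s) = C \<cdot> (l, 0, 0, 1)" by blast
qed

text \<open>A matrix of prime determinant \<open>l\<close> has rank one modulo \<open>l\<close>: it
  is singular there, and it cannot vanish because \<open>l^2\<close> does not divide
  \<open>l\<close>. Its kernel is therefore a single projective point, which picks out the
  representative.\<close>

lemma ex1_hermite:
  assumes l: "prime l" and A: "mat_det A = l"
  shows "\<exists>!B. B \<in> hermite_reps l \<and> (\<exists>C\<in>SL2Z. A = C \<cdot> B)"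
proof -
  obtain p q r s where pqrs: "A = (p, q, r, s)" by (cases A)
  have det: "p * s - q * r = l" using A by (simp add: pqrs)
  have l1: "l > 1" using l prime_gt_1_int by blast
  then have l0: "l \<noteq> 0" by simp
  note shear = left_coset_shear [OF l0 A [unfolded pqrs], folded pqrs]
  note diag = left_coset_diag [OF l0 A [unfolded pqrs], folded pqrs]
  show ?thesis
  proof (cases "l dvd p \<and> l dvd r")
    case True
    have "\<not> (l dvd p * t + q \<and> l dvd r * t + s)" for t
    proof
      assume "l dvd p * t + q \<and> l dvd r * t + s"
      then have "l dvd q" "l dvd s" using True by (simp_all add: dvd_add_right_iff)
      then have "l * l dvd p * s - q * r" using True by (intro dvd_diff mult_dvd_mono) auto
      then show False using det l1 by (simp add: zdvd_not_zless)
    qed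
    then have "\<And>B. B \<in> hermite_reps l \<Longrightarrow> \<exists>C\<in>SL2Z. A = C \<cdot> B \<Longrightarrow> B = (l, 0, 0, 1)"
      unfolding hermite_reps_def using shear by blast
    then show ?thesis
      using diag True unfolding hermite_reps_def by (intro ex1I [of _ "(l, 0, 0, 1)"]) auto
  next
    case False
    have "\<exists>!t. t \<in> {0..<l} \<and> l dvd p * t + q \<and> l dvd r * t + s"
    \<comment> \<open>Whichever of \<open>p\<close> and \<open>r\<close> is invertible modulo
      \<open>l\<close>, its row alone determines \<open>t\<close>; the determinant then gives the
      congruence for the other row.\<close>
    proof (cases "l dvd p")
      case p: False
      have "l dvd r * t + s" if "l dvd p * t + q" for t
      proof -
        have "p * (r * t + s) = r * (p * t + q) + l" using det by (simp add: algebra_simps)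
        then have "l dvd p * (r * t + s)" using that by simp
        then show ?thesis using l p prime_dvd_mult_iff by blast
      qed
      then show ?thesis using ex1_root_mod_prime [OF l p, of q] by blast
    next
      case True
      then have r: "\<not> l dvd r" using False by blast
      have "l dvd p * t + q" if "l dvd r * t + s" for t
      proof -
        have "r * (p * t + q) = p * (r * t + s) - l" using det by (simp add: algebra_simps)
        then have "l dvd r * (p * t + q)" using that by simp
        then show ?thesis using l r prime_dvd_mult_iff by blast
      qed
      then show ?thesis using ex1_root_mod_prime [OF l r, of s] by blast
    qed
    then obtain t where t: "t \<in> {0..<l}" "l dvd p * t + q \<and> l dvd r * t + s"
      and uniq: "\<And>t'. t' \<in> {0..<l} \<Longrightarrow> l dvd p * t' + q \<and> l dvd r * t' + s \<Longrightarrow> t' = t"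
      by blast
    show ?thesis
    proof (rule ex1I [of _ "(1, - t, 0, l)"])
      show "(1, - t, 0, l) \<in> hermite_reps l \<and> (\<exists>C\<in>SL2Z. A = C \<cdot> (1, - t, 0, l))"
        using t shear by (simp add: hermite_reps_def)
      fix B assume "B \<in> hermite_reps l \<and> (\<exists>C\<in>SL2Z. A = C \<cdot> B)"
      then show "B = (1, - t, 0, l)"
        unfolding hermite_reps_def using shear diag False uniq by blast
    qed
  qed
qed

section \<open>Counting matrices by cosets\<close>

lemma det_set_left_cosets:
  assumes "prime l"
  shows "{A. mat_det A = l \<and> P A} = (\<Union>B\<in>hermite_reps l. (\<lambda>C. C \<cdot> B) ` {C \<in> SL2Z. P (C \<cdot> B)})"
proof (intro equalityI subsetI)
  fix A assume A: "A \<in> {A. mat_det A = l \<and> P A}"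
  then obtain B C where "B \<in> hermite_reps l" "C \<in> SL2Z" "A = C \<cdot> B"
    using ex1_hermite [OF assms, of A] by blast
  then show "A \<in> (\<Union>B\<in>hermite_reps l. (\<lambda>C. C \<cdot> B) ` {C \<in> SL2Z. P (C \<cdot> B)})"
    using A by blast
next
  fix A assume "A \<in> (\<Union>B\<in>hermite_reps l. (\<lambda>C. C \<cdot> B) ` {C \<in> SL2Z. P (C \<cdot> B)})"
  then obtain B C where "B \<in> hermite_reps l" "C \<in> SL2Z" "A = C \<cdot> B" "P (C \<cdot> B)" by blast
  then show "A \<in> {A. mat_det A = l \<and> P A}"
    using mat_det_hermite by (simp add: mat_det_mul SL2Z_def)
qed

text \<open>\<open>P\<close> has to cut a finite piece out of each coset since \<open>SL2Z\<close>
  is infinite; the pieces are disjoint by \<open>ex1_hermite\<close>.\<close>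

lemma card_det_set_left:
  assumes l: "prime l" and fin: "\<And>B. B \<in> hermite_reps l \<Longrightarrow> finite {C \<in> SL2Z. P (C \<cdot> B)}"
  shows "card {A. mat_det A = l \<and> P A} = (\<Sum>B\<in>hermite_reps l. card {C \<in> SL2Z. P (C \<cdot> B)})"
proof -
  have l0: "l \<noteq> 0" using l by auto
  have "card (\<Union>B\<in>hermite_reps l. (\<lambda>C. C \<cdot> B) ` {C \<in> SL2Z. P (C \<cdot> B)}) =
    (\<Sum>B\<in>hermite_reps l. card ((\<lambda>C. C \<cdot> B) ` {C \<in> SL2Z. P (C \<cdot> B)}))"
  proof (rule card_UN_disjoint; (intro ballI impI)?)
    fix B B' assume B: "B \<in> hermite_reps l" "B' \<in> hermite_reps l" "B \<noteq> B'"
    show "(\<lambda>C. C \<cdot> B) ` {C \<in> SL2Z. P (C \<cdot> B)} \<inter> (\<lambda>C. C \<cdot> B') ` {C \<in> SL2Z. P (C \<cdot> B')} = {}"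
    proof (rule ccontr)
      assume "\<not> ?thesis"
      then obtain C C' where C: "C \<in> SL2Z" "C' \<in> SL2Z" "C \<cdot> B = C' \<cdot> B'" by blast
      then have "mat_det (C \<cdot> B) = l" using B mat_det_hermite by (simp add: mat_det_mul SL2Z_def)
      from ex1_hermite [OF l this] show False using B C by blast
    qed
  qed (use fin in auto)
  also have "\<dots> = (\<Sum>B\<in>hermite_reps l. card {C \<in> SL2Z. P (C \<cdot> B)})"
  proof (rule sum.cong [OF refl], rule card_image, rule inj_onI)
    fix B C C' assume "B \<in> hermite_reps l" "C \<cdot> B = C' \<cdot> B"
    then show "C = C'" using mat_mul_right_cancel [of B C C'] mat_det_hermite [of B l] l0 by blast
  qed
  finally show ?thesis by (simp add: det_set_left_cosets [OF l])
qed

lemma card_tr_set: "card {A. P A} = card {A. P (mat_tr A)}"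
  by (rule bij_betw_same_card [of mat_tr], rule bij_betw_byWitness [where f' = mat_tr])
    (auto simp del: mat_tr.simps)

lemma card_det_set_right:
  assumes l: "prime l" and fin: "\<And>B. B \<in> hermite_reps l \<Longrightarrow> finite {C \<in> SL2Z. P (mat_tr B \<cdot> C)}"
  shows "card {A. mat_det A = l \<and> P A} = (\<Sum>B\<in>hermite_reps l. card {C \<in> SL2Z. P (mat_tr B \<cdot> C)})"
proof -
  have eq: "{C \<in> SL2Z. P (mat_tr (C \<cdot> B))} = mat_tr ` {C \<in> SL2Z. P (mat_tr B \<cdot> C)}" for B
  proof (intro equalityI subsetI)
    fix C assume "C \<in> {C \<in> SL2Z. P (mat_tr (C \<cdot> B))}"
    then show "C \<in> mat_tr ` {C \<in> SL2Z. P (mat_tr B \<cdot> C)}"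
      by (intro image_eqI [of _ _ "mat_tr C"]) (simp_all add: mat_tr_mul SL2Z_tr)
  next
    fix C assume "C \<in> mat_tr ` {C \<in> SL2Z. P (mat_tr B \<cdot> C)}"
    then obtain C' where "C = mat_tr C'" "C' \<in> SL2Z" "P (mat_tr B \<cdot> C')" by blast
    then show "C \<in> {C \<in> SL2Z. P (mat_tr (C \<cdot> B))}" by (simp add: mat_tr_mul SL2Z_tr)
  qed
  have inj: "inj_on mat_tr X" for X
    by (rule inj_on_inverseI [of _ mat_tr]) simp
  have "card {A. mat_det A = l \<and> P A} = card {A. mat_det A = l \<and> P (mat_tr A)}"
    by (subst card_tr_set) simp
  also have "\<dots> = (\<Sum>B\<in>hermite_reps l. card {C \<in> SL2Z. P (mat_tr (C \<cdot> B))})"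
    by (rule card_det_set_left [OF l]) (simp only: eq, intro finite_imageI fin)
  also have "\<dots> = (\<Sum>B\<in>hermite_reps l. card {C \<in> SL2Z. P (mat_tr B \<cdot> C)})"
    by (simp only: eq card_image [OF inj])
  finally show ?thesis .
qed

subsection \<open>The Hecke correspondence\<close>

text \<open>For nonzero \<open>l\<close> the form \<open>f\<close> is determined by \<open>B\<close>
  and \<open>g\<close>, so these are the ways back from \<open>g\<close> along a matrix of
  determinant \<open>l\<close>.\<close>

definition descents :: "int \<Rightarrow> bqf \<Rightarrow> mat2 set" where
  "descents l g = {B \<in> hermite_reps l. \<exists>f. bqf_act f B = g}"

lemma bqf_stab_card_pos:
  assumes "D > 0" "f \<in> pos_forms D"
  shows "card (bqf_stab f) > 0"
  using card_bqf_stab [OF assms] by simp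

lemma finite_transporter:
  assumes "D > 0" "f \<in> pos_forms D"
  shows "finite (transporter f g)"
proof (cases "bqf_equiv f g")
  case True
  then have "card (transporter f g) > 0"
    using card_transporter(1) bqf_stab_card_pos [OF assms] by simp
  then show ?thesis using card_gt_0_iff by blast
qed (simp add: transporter_empty)

text \<open>Write \<open>A\<close> as \<open>mat_tr B\<close> times a unimodular \<open>C\<close>:
  the first factor takes \<open>f\<close> to the larger discriminant, and \<open>C\<close> ranges
  over a transporter to \<open>g\<close>.\<close>

lemma card_hecke_matrices_right:
  assumes l: "prime l" and D: "D > 0" and f: "f \<in> pos_forms D"
  shows "card {A. mat_det A = l \<and> bqf_act f A = g} =
    (\<Sum>B\<in>hermite_reps l. if bqf_equiv (bqf_act f (mat_tr B)) g then card (bqf_stab g) else 0)"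
proof -
  have eq: "{C \<in> SL2Z. bqf_act f (mat_tr B \<cdot> C) = g} = transporter (bqf_act f (mat_tr B)) g" for B
    by (simp add: transporter_def bqf_act_mul)
  have l0: "l \<noteq> 0" using l by auto
  have "card {A. mat_det A = l \<and> bqf_act f A = g} =
    (\<Sum>B\<in>hermite_reps l. card (transporter (bqf_act f (mat_tr B)) g))"
    unfolding eq [symmetric]
  proof (rule card_det_set_right [OF l])
    fix B assume "B \<in> hermite_reps l"
    then have "bqf_act f (mat_tr B) \<in> pos_forms (l\<^sup>2 * D)"
      using pos_forms_act [OF f, of "mat_tr B"] l0 mat_det_hermite by simp
    then show "finite {C \<in> SL2Z. bqf_act f (mat_tr B \<cdot> C) = g}"
      unfolding eq using D l0 by (intro finite_transporter [of "l\<^sup>2 * D"]) simp_all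
  qed
  also have "\<dots> = (\<Sum>B\<in>hermite_reps l.
      if bqf_equiv (bqf_act f (mat_tr B)) g then card (bqf_stab g) else 0)"
    by (intro sum.cong refl) (auto intro: card_transporter(2) simp: transporter_empty)
  finally show ?thesis .
qed

text \<open>Write \<open>A\<close> as a unimodular \<open>C\<close> times \<open>B\<close>: then
  \<open>C\<close> must carry \<open>f\<close> to the form \<open>h\<close> from which
  \<open>B\<close> produces \<open>g\<close>, and \<open>h\<close> is determined by \<open>B\<close>
  and \<open>g\<close>.\<close>

lemma card_hecke_matrices_left:
  assumes l: "prime l" and D: "D > 0" and f: "f \<in> pos_forms D"
  shows "card {A. mat_det A = l \<and> bqf_act f A = g} =
    (\<Sum>B\<in>hermite_reps l. if \<exists>h. bqf_act h B = g \<and> bqf_equiv f h then card (bqf_stab f) else 0)"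
proof -
  have l0: "l \<noteq> 0" using l by auto
  have eq: "{C \<in> SL2Z. bqf_act f (C \<cdot> B) = g} = transporter f h"
    if "B \<in> hermite_reps l" "bqf_act h B = g" for B h
  proof -
    have "bqf_act (bqf_act f C) B = g \<longleftrightarrow> bqf_act f C = h" for C
      unfolding that(2) [symmetric] by (rule bqf_act_hermite_inj [OF l0 that(1)])
    then show ?thesis by (simp add: transporter_def bqf_act_mul)
  qed
  have empty: "{C \<in> SL2Z. bqf_act f (C \<cdot> B) = g} = {}" if "\<nexists>h. bqf_act h B = g" for B
    unfolding bqf_act_mul using that by blast
  have "card {A. mat_det A = l \<and> bqf_act f A = g} =
    (\<Sum>B\<in>hermite_reps l. card {C \<in> SL2Z. bqf_act f (C \<cdot> B) = g})"
  proof (rule card_det_set_left [OF l])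
    fix B assume B: "B \<in> hermite_reps l"
    show "finite {C \<in> SL2Z. bqf_act f (C \<cdot> B) = g}"
    proof (cases "\<exists>h. bqf_act h B = g")
      case True
      then obtain h where h: "bqf_act h B = g" by blast
      show ?thesis unfolding eq [OF B h] by (rule finite_transporter [OF D f])
    next
      case False
      then show ?thesis unfolding empty [OF False] by blast
    qed
  qed
  also have "\<dots> = (\<Sum>B\<in>hermite_reps l.
      if \<exists>h. bqf_act h B = g \<and> bqf_equiv f h then card (bqf_stab f) else 0)"
  proof (rule sum.cong [OF refl])
    fix B assume B: "B \<in> hermite_reps l"
    show "card {C \<in> SL2Z. bqf_act f (C \<cdot> B) = g} =
      (if \<exists>h. bqf_act h B = g \<and> bqf_equiv f h then card (bqf_stab f) else 0)"
    proof (cases "\<exists>h. bqf_act h B = g")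
      case True
      then obtain h where h: "bqf_act h B = g" by blast
      have iff: "(\<exists>h. bqf_act h B = g \<and> bqf_equiv f h) \<longleftrightarrow> bqf_equiv f h"
        unfolding h [symmetric] bqf_act_hermite_inj [OF l0 B] by blast
      show ?thesis
        unfolding eq [OF B h] iff using card_transporter(1) [of f h] transporter_empty [of f h]
        by (cases "bqf_equiv f h") simp_all
    next
      case False
      then have "\<not> (\<exists>h. bqf_act h B = g \<and> bqf_equiv f h)" by blast
      then show ?thesis unfolding empty [OF False] by (simp only: if_False card.empty)
    qed
  qed
  finally show ?thesis .
qed

lemma sum_if_ex1:
  assumes "finite R" "\<exists>!x. x \<in> R \<and> P x"
  shows "(\<Sum>x\<in>R. if P x then k else 0) = (k :: 'a :: comm_monoid_add)"
proof -
  obtain x where x: "x \<in> R" "P x" "\<And>y. y \<in> R \<Longrightarrow> P y \<Longrightarrow> y = x" using assms(2) by blast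
  then have "P y \<longleftrightarrow> y = x" if "y \<in> R" for y using that by blast
  then have "(\<Sum>y\<in>R. if P y then k else 0) = (\<Sum>y\<in>R. if y = x then k else 0)"
    by (simp cong: sum.cong)
  then show ?thesis using assms(1) x(1) by simp
qed

text \<open>Both sides count the matrices \<open>A\<close> of determinant \<open>l\<close> carrying one representative \<open>f\<close> to
  another one \<open>g\<close>, weighted by \<open>1 / (|Stab f| |Stab g|)\<close>: on the left they are sorted by right
  cosets of \<open>SL\<^sub>2(\<int>)\<close>, on the right by left cosets.\<close>

lemma hecke_identity:
  assumes l: "prime l" and D: "D > 0" and R: "rep_system D R" and S: "rep_system (l\<^sup>2 * D) S"
  shows "of_int (l + 1) * (\<Sum>f\<in>R. 1 / of_nat (card (bqf_stab f)) :: rat) =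
    (\<Sum>g\<in>S. of_nat (card (descents l g)) / of_nat (card (bqf_stab g)))"
proof -
  have l1: "l > 1" using l prime_gt_1_int by blast
  then have l0: "l \<noteq> 0" by simp
  then have lD: "l\<^sup>2 * D > 0" using D by simp
  note fin = finite_rep_system [OF D R] finite_rep_system [OF lD S]
  define N where "N f g = (of_nat (card {A. mat_det A = l \<and> bqf_act f A = g}) :: rat)" for f g
  define w where "w f = (of_nat (card (bqf_stab f)) :: rat)" for f
  have wR: "w f \<noteq> 0" if "f \<in> R" for f
    using bqf_stab_card_pos [OF D rep_systemD(1) [OF R that]] by (simp add: w_def)
  have wS: "w g \<noteq> 0" if "g \<in> S" for g
    using bqf_stab_card_pos [OF lD rep_systemD(1) [OF S that]] by (simp add: w_def)
  have right: "(\<Sum>g\<in>S. N f g / (w f * w g)) = of_int (l + 1) * (1 / w f)" if f: "f \<in> R" for f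
  proof -
    have fD: "f \<in> pos_forms D" using rep_systemD(1) [OF R f] .
    have "(\<Sum>g\<in>S. N f g / (w f * w g)) = (\<Sum>g\<in>S. \<Sum>B\<in>hermite_reps l.
        if bqf_equiv (bqf_act f (mat_tr B)) g then 1 / w f else 0)"
    proof (rule sum.cong [OF refl])
      fix g assume g: "g \<in> S"
      have *: "N f g = (\<Sum>B\<in>hermite_reps l. if bqf_equiv (bqf_act f (mat_tr B)) g then w g else 0)"
        unfolding N_def w_def card_hecke_matrices_right [OF l D fD]
        by (simp only: of_nat_sum if_distrib [of rat_of_nat] of_nat_0)
      then show "N f g / (w f * w g) =
        (\<Sum>B\<in>hermite_reps l. if bqf_equiv (bqf_act f (mat_tr B)) g then 1 / w f else 0)"
        using wS [OF g] unfolding * sum_divide_distrib by (intro sum.cong refl) simp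
    qed
    also have "\<dots> = (\<Sum>B\<in>hermite_reps l. \<Sum>g\<in>S.
        if bqf_equiv (bqf_act f (mat_tr B)) g then 1 / w f else 0)"
      by (rule sum.swap)
    \<comment> \<open>For each of the \<open>l + 1\<close> matrices \<open>B\<close> the resulting
      form is equivalent to exactly one member of \<open>S\<close>.\<close>
    also have "\<dots> = (\<Sum>B\<in>hermite_reps l. 1 / w f)"
    proof (rule sum.cong [OF refl])
      fix B assume "B \<in> hermite_reps l"
      then have "bqf_act f (mat_tr B) \<in> pos_forms (l\<^sup>2 * D)"
        using pos_forms_act [OF fD, of "mat_tr B"] l0 mat_det_hermite by simp
      then show "(\<Sum>g\<in>S. if bqf_equiv (bqf_act f (mat_tr B)) g then 1 / w f else 0) = 1 / w f"
        by (intro sum_if_ex1 fin rep_systemD(2) [OF S])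
    qed
    finally show ?thesis using l1 by (simp add: card_hermite_reps)
  qed
  have left: "(\<Sum>f\<in>R. N f g / (w f * w g)) = of_nat (card (descents l g)) / w g" if g: "g \<in> S" for g
  proof -
    have gD: "g \<in> pos_forms (l\<^sup>2 * D)" using rep_systemD(1) [OF S g] .
    have "(\<Sum>f\<in>R. N f g / (w f * w g)) = (\<Sum>f\<in>R. \<Sum>B\<in>hermite_reps l.
        if \<exists>h. bqf_act h B = g \<and> bqf_equiv f h then 1 / w g else 0)"
    proof (rule sum.cong [OF refl])
      fix f assume f: "f \<in> R"
      have *: "N f g = (\<Sum>B\<in>hermite_reps l.
          if \<exists>h. bqf_act h B = g \<and> bqf_equiv f h then w f else 0)"
        unfolding N_def w_def card_hecke_matrices_left [OF l D rep_systemD(1) [OF R f]]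
        by (simp only: of_nat_sum if_distrib [of rat_of_nat] of_nat_0)
      have "w f / (w f * w g) = 1 / w g" using wR [OF f] by simp
      with * show "N f g / (w f * w g) = (\<Sum>B\<in>hermite_reps l.
          if \<exists>h. bqf_act h B = g \<and> bqf_equiv f h then 1 / w g else 0)"
        by (simp only: sum_divide_distrib if_distrib [of "\<lambda>x. x / (w f * w g)"] div_0)
    qed
    also have "\<dots> = (\<Sum>B\<in>hermite_reps l. \<Sum>f\<in>R.
        if \<exists>h. bqf_act h B = g \<and> bqf_equiv f h then 1 / w g else 0)"
      by (rule sum.swap)
    \<comment> \<open>If \<open>g\<close> comes from some \<open>h\<close> along \<open>B\<close>,
      then \<open>h\<close> has discriminant \<open>-D\<close> and meets exactly one member of
      \<open>R\<close>; otherwise every term is zero.\<close>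
    also have "\<dots> = (\<Sum>B\<in>hermite_reps l. if \<exists>h. bqf_act h B = g then 1 / w g else 0)"
    proof (rule sum.cong [OF refl])
      fix B assume B: "B \<in> hermite_reps l"
      show "(\<Sum>f\<in>R. if \<exists>h. bqf_act h B = g \<and> bqf_equiv f h then 1 / w g else 0) =
        (if \<exists>h. bqf_act h B = g then 1 / w g else 0)"
      proof (cases "\<exists>h. bqf_act h B = g")
        case True
        then obtain h where h: "bqf_act h B = g" by blast
        have iff: "(\<exists>h. bqf_act h B = g \<and> bqf_equiv f h) \<longleftrightarrow> bqf_equiv h f" for f
          unfolding h [symmetric] bqf_act_hermite_inj [OF l0 B] using bqf_equiv_sym by blast
        have "h \<in> pos_forms D"
          using pos_forms_of_act [of h B D] h gD mat_det_hermite [OF B] l0 by simp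
        from sum_if_ex1 [OF fin(1) rep_systemD(2) [OF R this]] True show ?thesis
          by (simp only: iff if_True)
      next
        case False
        then have "\<not> (\<exists>h. bqf_act h B = g \<and> bqf_equiv f h)" for f by blast
        with False show ?thesis by (simp only: if_False sum.neutral_const)
      qed
    qed
    also have "\<dots> = (\<Sum>B\<in>descents l g. 1 / w g)"
      unfolding descents_def by (rule sum.inter_filter [symmetric]) simp
    finally show ?thesis by simp
  qed
  have "of_int (l + 1) * (\<Sum>f\<in>R. 1 / w f) = (\<Sum>f\<in>R. \<Sum>g\<in>S. N f g / (w f * w g))"
    unfolding sum_distrib_left by (intro sum.cong refl right [symmetric])
  also have "\<dots> = (\<Sum>g\<in>S. \<Sum>f\<in>R. N f g / (w f * w g))" by (rule sum.swap)
  also have "\<dots> = (\<Sum>g\<in>S. of_nat (card (descents l g)) / w g)" by (intro sum.cong refl left)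
  finally show ?thesis by (simp add: w_def)
qed

subsection \<open>Counting descents\<close>

lemma card_ex1: "\<exists>!x. x \<in> A \<and> P x \<Longrightarrow> card {x \<in> A. P x} = 1"
proof -
  assume "\<exists>!x. x \<in> A \<and> P x"
  then obtain x where "x \<in> A" "P x" "\<And>y. y \<in> A \<Longrightarrow> P y \<Longrightarrow> y = x" by blast
  then have "{x \<in> A. P x} = {x}" by blast
  then show ?thesis by simp
qed

text \<open>Solve for the original form. Along the diagonal matrix it is
  \<open>(a / l^2, b / l, c)\<close>; along the matrix of \<open>t\<close> it is \<open>a\<close>,
  \<open>(2 a t + b) / l\<close> and \<open>(a t^2 + b t + c) / l^2\<close>. The conditions are the
  integrality of these entries.\<close>

lemma card_descents:
  assumes l: "l > 1"
  shows "card (descents l (a, b, c)) = (if l\<^sup>2 dvd a \<and> l dvd b then 1 else 0) +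
    card {t \<in> {0..<l}. l dvd 2 * a * t + b \<and> l\<^sup>2 dvd a * t\<^sup>2 + b * t + c}"
proof -
  define P where "P B \<longleftrightarrow> (\<exists>f. bqf_act f B = (a, b, c))" for B
  have diag: "P (l, 0, 0, 1) \<longleftrightarrow> l\<^sup>2 dvd a \<and> l dvd b"
    unfolding P_def by (auto simp: dvd_def mult.commute)
  have shear: "P (1, - t, 0, l) \<longleftrightarrow>
    l dvd 2 * a * t + b \<and> l\<^sup>2 dvd a * t\<^sup>2 + b * t + c" for t
  proof
    assume "P (1, - t, 0, l)"
    then obtain a' b' c' where "bqf_act (a', b', c') (1, - t, 0, l) = (a, b, c)"
      unfolding P_def by (metis prod_cases3)
    moreover have "bqf_act (a', b', c') (1, - t, 0, l) =
        (a', l * b' - 2 * a' * t, a' * t\<^sup>2 - l * b' * t + l\<^sup>2 * c')"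
      by (simp add: algebra_simps)
    ultimately have "(a, b, c) = (a', l * b' - 2 * a' * t, a' * t\<^sup>2 - l * b' * t + l\<^sup>2 * c')"
      by (rule trans [OF sym])
    then have eqs: "a = a'" "b = l * b' - 2 * a' * t" "c = a' * t\<^sup>2 - l * b' * t + l\<^sup>2 * c'"
      by (simp_all only: prod.inject)
    have "2 * a * t + b = l * b'" "a * t\<^sup>2 + b * t + c = l\<^sup>2 * c'"
      unfolding eqs by (simp_all add: power2_eq_square algebra_simps)
    then show "l dvd 2 * a * t + b \<and> l\<^sup>2 dvd a * t\<^sup>2 + b * t + c" by simp
  next
    assume "l dvd 2 * a * t + b \<and> l\<^sup>2 dvd a * t\<^sup>2 + b * t + c"
    then obtain x y where xy: "2 * a * t + b = l * x" "a * t\<^sup>2 + b * t + c = l\<^sup>2 * y"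
      by (auto simp: dvd_def)
    have "bqf_act (a, x, y) (1, - t, 0, l) =
        (a, l * x - 2 * a * t, a * t\<^sup>2 - l * x * t + l\<^sup>2 * y)"
      by (simp add: algebra_simps)
    also have "\<dots> = (a, b, c)"
      unfolding xy [symmetric] by (simp add: power2_eq_square algebra_simps)
    finally have "bqf_act (a, x, y) (1, - t, 0, l) = (a, b, c)" .
    then show "P (1, - t, 0, l)" unfolding P_def by blast
  qed
  let ?Z = "{t \<in> {0..<l}. l dvd 2 * a * t + b \<and> l\<^sup>2 dvd a * t\<^sup>2 + b * t + c}"
  have "descents l (a, b, c) = (if P (l, 0, 0, 1) then {(l, 0, 0, 1)} else {}) \<union>
      (\<lambda>t. (1, - t, 0, l)) ` {t \<in> {0..<l}. P (1, - t, 0, l)}"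
    unfolding descents_def hermite_reps_def P_def [symmetric] by auto
  then have eq: "descents l (a, b, c) =
    (if l\<^sup>2 dvd a \<and> l dvd b then {(l, 0, 0, 1)} else {}) \<union> (\<lambda>t. (1, - t, 0, l)) ` ?Z"
    unfolding diag shear .
  have "finite ?Z" by (rule finite_subset [of _ "{0..<l}"]) auto
  then have "card (descents l (a, b, c)) =
      card (if l\<^sup>2 dvd a \<and> l dvd b then {(l, 0, 0, 1) :: mat2} else {}) +
      card ((\<lambda>t. (1, - t, 0, l) :: mat2) ` ?Z)"
    unfolding eq using l by (intro card_Un_disjoint finite_imageI) auto
  moreover have "card ((\<lambda>t. (1, - t, 0, l) :: mat2) ` ?Z) = card ?Z"
    by (rule card_image) (auto simp: inj_on_def)
  ultimately show ?thesis by simp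
qed

text \<open>Modulo \<open>l\<close> the form is nonzero of discriminant zero, so it has one double
  zero on the projective line. Because \<open>l^2\<close> divides the discriminant, the value at a
  lift of that zero is automatically divisible by \<open>l^2\<close>.\<close>

lemma card_descents_primitive:
  assumes l: "prime l" "l > 2" and disc: "4 * a * c = b\<^sup>2 + l\<^sup>2 * D"
    and prim: "\<not> (l dvd a \<and> l dvd b \<and> l dvd c)"
  shows "card (descents l (a, b, c)) = 1"
proof (cases "l dvd a")
  case False
  have l2: "\<not> l dvd 2" using l by (auto dest: zdvd_imp_le)
  have "\<not> l dvd 2 * a" using False l2 l(1) by (simp add: prime_dvd_mult_iff)
  have "\<not> l dvd 4 * a" using \<open>\<not> l dvd 2 * a\<close> l2 l(1) prime_dvd_mult_iff [of l 2 "2 * a"] by simp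
  then have cop: "coprime (l\<^sup>2) (4 * a)" using prime_imp_coprime [OF l(1)] by (metis coprime_power_left_iff)
  have "l\<^sup>2 dvd a * t\<^sup>2 + b * t + c" if "l dvd 2 * a * t + b" for t
  proof -
    have "4 * a * (a * t\<^sup>2 + b * t + c) = (2 * a * t + b)\<^sup>2 + (4 * a * c - b\<^sup>2)"
      by (simp add: power2_eq_square algebra_simps)
    also have "\<dots> = (2 * a * t + b)\<^sup>2 + l\<^sup>2 * D" using disc by simp
    finally have "l\<^sup>2 dvd 4 * a * (a * t\<^sup>2 + b * t + c)" using that by simp
    then show ?thesis using cop coprime_dvd_mult_right_iff by blast
  qed
  then have "\<exists>!t. t \<in> {0..<l} \<and> (l dvd 2 * a * t + b \<and> l\<^sup>2 dvd a * t\<^sup>2 + b * t + c)"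
    using ex1_root_mod_prime [OF l(1) \<open>\<not> l dvd 2 * a\<close>, of b] by blast
  then have "card {t \<in> {0..<l}. l dvd 2 * a * t + b \<and> l\<^sup>2 dvd a * t\<^sup>2 + b * t + c} = 1"
    by (rule card_ex1)
  moreover have "\<not> l\<^sup>2 dvd a" using False by (meson dvd_trans dvd_power pos2)
  ultimately show ?thesis using l by (simp add: card_descents)
next
  case True
  have l2: "\<not> l dvd 2" using l by (auto dest: zdvd_imp_le)
  have b2: "b\<^sup>2 = 4 * a * c - l\<^sup>2 * D" using disc by simp
  have "l dvd b\<^sup>2" unfolding b2 using True by (simp add: power2_eq_square)
  then have b: "l dvd b" using l(1) prime_dvd_power by blast
  then have c: "\<not> l dvd c" using prim True by blast
  have "\<not> l dvd 4 * c" using c l2 l(1) prime_dvd_mult_iff [of l 2 "2 * c"] by (simp add: prime_dvd_mult_iff)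
  then have cop: "coprime (l\<^sup>2) (4 * c)" using prime_imp_coprime [OF l(1)] by (metis coprime_power_left_iff)
  have "l\<^sup>2 dvd 4 * c * a" using b disc by (simp add: mult.commute mult.left_commute)
  then have "l\<^sup>2 dvd a" using cop coprime_dvd_mult_right_iff by blast
  moreover have "\<not> l\<^sup>2 dvd a * t\<^sup>2 + b * t + c" for t
  proof
    assume "l\<^sup>2 dvd a * t\<^sup>2 + b * t + c"
    then have "l dvd a * t\<^sup>2 + b * t + c" by (meson dvd_trans dvd_power pos2)
    moreover have "l dvd a * t\<^sup>2 + b * t" using True b by simp
    ultimately show False using c dvd_add_right_iff by blast
  qed
  ultimately show ?thesis using l b by (simp add: card_descents)
qed

text \<open>The number of zeros on the projective line over \<open>\<int> / l\<close>, the first summand standing for the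
  point \<open>(1 : 0)\<close>.\<close>

fun proj_zeros :: "int \<Rightarrow> bqf \<Rightarrow> nat" where
  "proj_zeros l (a, b, c) =
     (if l dvd a then 1 else 0) + card {t \<in> {0..<l}. l dvd a * t\<^sup>2 + b * t + c}"

text \<open>The factor \<open>l\<close> satisfies the conditions modulo \<open>l\<close> outright
  and weakens those modulo \<open>l^2\<close> to divisibility by \<open>l\<close>.\<close>

lemma card_descents_scale:
  assumes "l > 1"
  shows "card (descents l (bqf_scale l f)) = proj_zeros l f"
proof -
  obtain a b c where f: "f = (a, b, c)" by (cases f)
  have "l dvd 2 * (l * a) * t + l * b" for t by simp
  moreover have "l * a * t\<^sup>2 + l * b * t + l * c = l * (a * t\<^sup>2 + b * t + c)" for t
    by (simp add: algebra_simps)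
  ultimately show ?thesis using assms by (simp add: f card_descents power2_eq_square)
qed

text \<open>By the quadratic formula the zeros satisfy \<open>2 a t + b = s\<close> or
  \<open>- s\<close> modulo \<open>l\<close>, and these differ. If \<open>l\<close> divides
  \<open>a\<close>, then \<open>b\<close> is invertible: one zero is \<open>(1 : 0)\<close>, the
  other solves a linear congruence.\<close>

lemma proj_zeros_split:
  assumes l: "prime l" "l > 2" and disc: "4 * a * c = b\<^sup>2 + D"
    and D: "\<not> l dvd D" "l dvd s\<^sup>2 + D"
  shows "proj_zeros l (a, b, c) = 2"
proof (cases "l dvd a")
  case False
  have l2: "\<not> l dvd 2" using l by (auto dest: zdvd_imp_le)
  have a2: "\<not> l dvd 2 * a" using False l2 l(1) by (simp add: prime_dvd_mult_iff)
  then have a4: "\<not> l dvd 4 * a" using l2 l(1) prime_dvd_mult_iff [of l 2 "2 * a"] by simp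
  have s: "\<not> l dvd 2 * s"
  proof
    assume "l dvd 2 * s"
    then have "l dvd s\<^sup>2" using l2 l(1) by (simp add: prime_dvd_mult_iff power2_eq_square)
    then show False using D dvd_add_right_iff by blast
  qed
  obtain t1 where t1: "t1 \<in> {0..<l}" "l dvd 2 * a * t1 + (b - s)"
    and u1: "\<And>t. t \<in> {0..<l} \<Longrightarrow> l dvd 2 * a * t + (b - s) \<Longrightarrow> t = t1"
    using ex1_root_mod_prime [OF l(1) a2, of "b - s"] by blast
  obtain t2 where t2: "t2 \<in> {0..<l}" "l dvd 2 * a * t2 + (b + s)"
    and u2: "\<And>t. t \<in> {0..<l} \<Longrightarrow> l dvd 2 * a * t + (b + s) \<Longrightarrow> t = t2"
    using ex1_root_mod_prime [OF l(1) a2, of "b + s"] by blast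
  have "t1 \<noteq> t2"
  proof
    assume "t1 = t2"
    then have "l dvd (2 * a * t1 + (b + s)) - (2 * a * t1 + (b - s))"
      using t1 t2 by (intro dvd_diff) auto
    then show False using s by simp
  qed
  have "l dvd a * t\<^sup>2 + b * t + c \<longleftrightarrow> l dvd 2 * a * t + (b - s) \<or> l dvd 2 * a * t + (b + s)" for t
  proof -
    have "4 * a * (a * t\<^sup>2 + b * t + c) =
        (2 * a * t + (b - s)) * (2 * a * t + (b + s)) + (s\<^sup>2 + (4 * a * c - b\<^sup>2))"
      by (simp add: power2_eq_square algebra_simps)
    also have "\<dots> = (2 * a * t + (b - s)) * (2 * a * t + (b + s)) + (s\<^sup>2 + D)"
      using disc by simp
    finally have "l dvd 4 * a * (a * t\<^sup>2 + b * t + c) \<longleftrightarrow>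
        l dvd (2 * a * t + (b - s)) * (2 * a * t + (b + s))"
      using D(2) by (simp only: dvd_add_left_iff)
    then show ?thesis using a4 l(1) by (simp only: prime_dvd_mult_iff) blast
  qed
  then have "{t \<in> {0..<l}. l dvd a * t\<^sup>2 + b * t + c} = {t1, t2}"
    using t1 t2 u1 u2 by blast
  then show ?thesis using False \<open>t1 \<noteq> t2\<close> by simp
next
  case True
  have "\<not> l dvd b"
  proof
    assume "l dvd b"
    then have "l dvd 4 * a * c - b\<^sup>2" using True by (simp add: power2_eq_square)
    then show False using disc D(1) by simp
  qed
  moreover have "l dvd a * t\<^sup>2 + b * t + c \<longleftrightarrow> l dvd b * t + c" for t
    using True by (simp add: add.assoc dvd_add_right_iff)
  ultimately show ?thesis
    using True card_ex1 [OF ex1_root_mod_prime [OF l(1), of b c]] by simp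
qed

text \<open>The discriminant vanishes modulo \<open>l\<close>, so the only zero is the double one;
  it is \<open>(1 : 0)\<close> exactly when \<open>l\<close> divides \<open>a\<close>.\<close>

lemma proj_zeros_ramified:
  assumes l: "prime l" "l > 2" and disc: "4 * a * c = b\<^sup>2 + D"
    and D: "l dvd D" and prim: "\<not> (l dvd a \<and> l dvd b \<and> l dvd c)"
  shows "proj_zeros l (a, b, c) = 1"
proof (cases "l dvd a")
  case False
  have l2: "\<not> l dvd 2" using l by (auto dest: zdvd_imp_le)
  have a2: "\<not> l dvd 2 * a" using False l2 l(1) by (simp add: prime_dvd_mult_iff)
  then have a4: "\<not> l dvd 4 * a" using l2 l(1) prime_dvd_mult_iff [of l 2 "2 * a"] by simp
  have "l dvd a * t\<^sup>2 + b * t + c \<longleftrightarrow> l dvd 2 * a * t + b" for t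
  proof -
    have "4 * a * (a * t\<^sup>2 + b * t + c) =
        (2 * a * t + b) * (2 * a * t + b) + (4 * a * c - b\<^sup>2)"
      by (simp add: power2_eq_square algebra_simps)
    also have "\<dots> = (2 * a * t + b) * (2 * a * t + b) + D"
      using disc by simp
    finally have "l dvd 4 * a * (a * t\<^sup>2 + b * t + c) \<longleftrightarrow> l dvd (2 * a * t + b) * (2 * a * t + b)"
      using D by (simp only: dvd_add_left_iff)
    then show ?thesis using a4 l(1) by (simp only: prime_dvd_mult_iff) blast
  qed
  then show ?thesis
    using False card_ex1 [OF ex1_root_mod_prime [OF l(1) a2, of b]] by simp
next
  case True
  have "b\<^sup>2 = 4 * a * c - D" using disc by simp
  then have "l dvd b\<^sup>2" using True D by simp
  then have b: "l dvd b" using l(1) prime_dvd_power by blast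
  then have c: "\<not> l dvd c" using prim True by blast
  have "\<not> l dvd a * t\<^sup>2 + b * t + c" for t
    using c True b by (simp add: dvd_add_right_iff)
  then show ?thesis using True by simp
qed

text \<open>The form is zero modulo \<open>l\<close> and vanishes at all \<open>l + 1\<close>
  points.\<close>

lemma proj_zeros_scale: "l > 0 \<Longrightarrow> proj_zeros l (bqf_scale l f) = nat l + 1"
proof -
  assume "l > 0"
  obtain a b c where f: "f = (a, b, c)" by (cases f)
  have "l * a * t\<^sup>2 + l * b * t + l * c = l * (a * t\<^sup>2 + b * t + c)" for t
    by (simp add: algebra_simps)
  then have "{t \<in> {0..<l}. l dvd l * a * t\<^sup>2 + l * b * t + l * c} = {0..<l}" by auto
  then show ?thesis by (simp add: f)
qed

lemma in_range_bqf_scale: "(a, b, c) \<in> range (bqf_scale l) \<longleftrightarrow> l dvd a \<and> l dvd b \<and> l dvd c"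
proof
  assume "l dvd a \<and> l dvd b \<and> l dvd c"
  then obtain x y z where "a = l * x" "b = l * y" "c = l * z" by (auto simp: dvd_def)
  then show "(a, b, c) \<in> range (bqf_scale l)" by (intro image_eqI [of _ _ "(x, y, z)"]) auto
qed auto

subsection \<open>Hecke relations for Hurwitz class numbers\<close>

lemma sum_over_scaled:
  assumes S: "finite S" and l: "l \<noteq> 0" and zero: "\<And>g. g \<in> S \<Longrightarrow> g \<notin> range (bqf_scale l) \<Longrightarrow> F g = 0"
  shows "sum F S = (\<Sum>f\<in>{f. bqf_scale l f \<in> S}. F (bqf_scale l f))"
proof -
  have "sum F S = sum F (bqf_scale l ` {f. bqf_scale l f \<in> S})"
    by (rule sum.mono_neutral_right) (use S zero in blast)+
  also have "\<dots> = (\<Sum>f\<in>{f. bqf_scale l f \<in> S}. F (bqf_scale l f))"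
    by (subst sum.reindex) (simp_all add: inj_on_def bqf_scale_inj [OF l])
  finally show ?thesis .
qed

text \<open>Subtracting 1 from each descent count splits off the class number of
  \<open>l^2 D\<close>. The remainder vanishes at forms not divisible by \<open>l\<close>, and at
  \<open>l f\<close> it counts the zeros of \<open>f\<close> less one.\<close>

lemma hurwitz_hecke:
  assumes l: "prime l" "l > 2" and D: "D > 0"
  obtains R where "rep_system D R"
    "of_int (l + 1) * hurwitz_class_number D = hurwitz_class_number (l\<^sup>2 * D) +
      2 * (\<Sum>f\<in>R. (of_nat (proj_zeros l f) - 1) / of_nat (card (bqf_stab f)))"
proof -
  have lD: "l\<^sup>2 * D > 0" and l0: "l \<noteq> 0" using l D by auto
  obtain S where S: "rep_system (l\<^sup>2 * D) S" using ex_rep_system by blast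
  \<comment> \<open>\<open>S\<close> is fixed first and \<open>R\<close> derived from it, so that
    the members of \<open>S\<close> divisible by \<open>l\<close> are exactly the multiples
    \<open>l f\<close> with \<open>f\<close> in \<open>R\<close>.\<close>
  define R where "R = {f. bqf_scale l f \<in> S}"
  have R: "rep_system D R" unfolding R_def using rep_system_unscale [OF _ S] l by simp
  define F where "F g = (of_nat (card (descents l g)) - 1) / (of_nat (card (bqf_stab g)) :: rat)" for g
  have "F g = 0" if g: "g \<in> S" "g \<notin> range (bqf_scale l)" for g
  proof -
    obtain a b c where abc: "g = (a, b, c)" by (cases g)
    have "4 * a * c = b\<^sup>2 + l\<^sup>2 * D"
      using rep_systemD(1) [OF S g(1)] pos_forms_iff [OF lD] by (simp add: abc)
    then have "card (descents l g) = 1"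
      using card_descents_primitive [OF l] g(2) unfolding abc in_range_bqf_scale by blast
    then show ?thesis by (simp add: F_def)
  qed
  then have "sum F S = (\<Sum>f\<in>R. F (bqf_scale l f))"
    unfolding R_def by (intro sum_over_scaled finite_rep_system [OF lD S] l0)
  also have "\<dots> = (\<Sum>f\<in>R. (of_nat (proj_zeros l f) - 1) / of_nat (card (bqf_stab f)))"
    using l by (simp add: F_def card_descents_scale transporter_scale [OF l0])
  finally have F: "sum F S = (\<Sum>f\<in>R. (of_nat (proj_zeros l f) - 1) / of_nat (card (bqf_stab f)))" .
  have "of_int (l + 1) * hurwitz_class_number D =
      2 * (of_int (l + 1) * (\<Sum>f\<in>R. 1 / of_nat (card (bqf_stab f))))"
    by (simp add: hurwitz_class_number_eq [OF D R])
  also have "\<dots> = 2 * (\<Sum>g\<in>S. of_nat (card (descents l g)) / of_nat (card (bqf_stab g)))"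
    unfolding hecke_identity [OF l(1) D R S] ..
  also have "(\<Sum>g\<in>S. of_nat (card (descents l g)) / of_nat (card (bqf_stab g))) =
      (\<Sum>g\<in>S. 1 / of_nat (card (bqf_stab g)) :: rat) + sum F S"
    unfolding sum.distrib [symmetric] F_def
    by (intro sum.cong refl) (simp add: diff_divide_distrib)
  finally show ?thesis
    using that [OF R] by (simp add: hurwitz_class_number_eq [OF lD S] F distrib_left)
qed

text \<open>Two zeros for each form make the correction term equal to \<open>H(D)\<close>, leaving
  \<open>l + 1 - 1\<close>.\<close>

lemma hurwitz_split:
  assumes l: "prime l" "l > 2" and D: "D > 0" "\<not> l dvd D" "l dvd s\<^sup>2 + D"
  shows "hurwitz_class_number (l\<^sup>2 * D) = of_int l * hurwitz_class_number D"
proof -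
  obtain R where R: "rep_system D R" and eq:
    "of_int (l + 1) * hurwitz_class_number D = hurwitz_class_number (l\<^sup>2 * D) +
      2 * (\<Sum>f\<in>R. (of_nat (proj_zeros l f) - 1) / of_nat (card (bqf_stab f)))"
    by (rule hurwitz_hecke [OF l D(1)])
  have "proj_zeros l f = 2" if "f \<in> R" for f
  proof -
    obtain a b c where abc: "f = (a, b, c)" by (cases f)
    have "4 * a * c = b\<^sup>2 + D"
      using rep_systemD(1) [OF R that] pos_forms_iff [OF D(1)] by (simp add: abc)
    then show ?thesis unfolding abc by (rule proj_zeros_split [OF l _ D(2,3)])
  qed
  then have "2 * (\<Sum>f\<in>R. (of_nat (proj_zeros l f) - 1) / of_nat (card (bqf_stab f))) =
      hurwitz_class_number D"
    by (simp add: hurwitz_class_number_eq [OF D(1) R])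
  with eq show ?thesis by (simp add: distrib_right)
qed

text \<open>In discriminant \<open>-l^2 D\<close> only the multiples of \<open>l\<close> have other
  than one zero. Each has excess \<open>l\<close>, which adds up to \<open>l H(D)\<close>.\<close>

lemma hurwitz_hecke_square:
  assumes l: "prime l" "l > 2" and D: "D > 0"
  shows "hurwitz_class_number (l\<^sup>2 * (l\<^sup>2 * D)) =
    of_int (l + 1) * hurwitz_class_number (l\<^sup>2 * D) - of_int l * hurwitz_class_number D"
proof -
  have lD: "l\<^sup>2 * D > 0" and l0: "l \<noteq> 0" using l D by auto
  obtain R where R: "rep_system (l\<^sup>2 * D) R" and eq:
    "of_int (l + 1) * hurwitz_class_number (l\<^sup>2 * D) = hurwitz_class_number (l\<^sup>2 * (l\<^sup>2 * D)) +
      2 * (\<Sum>f\<in>R. (of_nat (proj_zeros l f) - 1) / of_nat (card (bqf_stab f)))"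
    by (rule hurwitz_hecke [OF l lD])
  define R' where "R' = {f. bqf_scale l f \<in> R}"
  have R': "rep_system D R'" unfolding R'_def using rep_system_unscale [OF _ R] l by simp
  define F where "F g = (of_nat (proj_zeros l g) - 1) / (of_nat (card (bqf_stab g)) :: rat)" for g
  have "F g = 0" if g: "g \<in> R" "g \<notin> range (bqf_scale l)" for g
  proof -
    obtain a b c where abc: "g = (a, b, c)" by (cases g)
    have "4 * a * c = b\<^sup>2 + l\<^sup>2 * D"
      using rep_systemD(1) [OF R g(1)] pos_forms_iff [OF lD] by (simp add: abc)
    then have "proj_zeros l g = 1"
      using proj_zeros_ramified [OF l] g(2) unfolding abc in_range_bqf_scale
      by (simp add: power2_eq_square)
    then show ?thesis by (simp add: F_def)
  qed
  then have "sum F R = (\<Sum>f\<in>R'. F (bqf_scale l f))"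
    unfolding R'_def by (intro sum_over_scaled finite_rep_system [OF lD R] l0)
  also have "\<dots> = (\<Sum>f\<in>R'. of_int l * (1 / of_nat (card (bqf_stab f))))"
    using l by (simp add: F_def proj_zeros_scale transporter_scale [OF l0])
  finally have "2 * sum F R = of_int l * hurwitz_class_number D"
    by (simp add: hurwitz_class_number_eq [OF D R'] sum_distrib_left mult.commute)
  with eq show ?thesis by (simp add: F_def)
qed

text \<open>The recurrence has characteristic roots 1 and \<open>l\<close>; the initial values
  \<open>H(D)\<close> and \<open>l H(D)\<close> select the pure power of \<open>l\<close>.\<close>

lemma hurwitz_split_power:
  assumes l: "prime l" "l > 2" and D: "D > 0" "\<not> l dvd D" "l dvd s\<^sup>2 + D"
  shows "hurwitz_class_number (l ^ (2 * k) * D) = of_int (l ^ k) * hurwitz_class_number D"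
proof (induction k rule: induct_nat_012)
  case 0
  show ?case by simp
next
  case 1
  show ?case using hurwitz_split [OF l D] by simp
next
  case (ge2 k)
  have "l ^ (2 * k) * D > 0" using l D by simp
  from hurwitz_hecke_square [OF l this] ge2 show ?case
    by (simp add: power2_eq_square algebra_simps)
qed

subsection \<open>Integrality\<close>

text \<open>The reduced denominator of \<open>x\<close> divides any integer \<open>k\<close> that
  clears it.\<close>

lemma integral_at_divisor:
  assumes "prime l" "\<not> l dvd k" "of_int k * x \<in> \<int>"
  shows "x \<in> integral_at l"
proof -
  obtain p q where pq: "quotient_of x = (p, q)" by (cases "quotient_of x")
  have q: "q > 0" "coprime p q" "x = of_int p / of_int q"
    using quotient_of_denom_pos [OF pq] quotient_of_coprime [OF pq] quotient_of_div [OF pq] by auto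
  obtain n where "of_int k * x = of_int n" using assms(3) Ints_cases by blast
  then have "(of_int (k * p) :: rat) = of_int (n * q)" using q by (simp add: field_simps)
  then have "k * p = n * q" by (simp only: of_int_eq_iff)
  then have "q dvd k * p" by simp
  then have "q dvd k" using q(2) by (simp add: coprime_commute coprime_dvd_mult_left_iff)
  then show ?thesis using assms(2) pq dvd_trans by (auto simp: integral_at_def)
qed

text \<open>The class weights have denominators 1, 2 and 3; the 12 is that of
  \<open>H(0)\<close>.\<close>

lemma hurwitz_class_number_denominator: "12 * hurwitz_class_number D \<in> \<int>"
proof -
  have "12 * class_weight C \<in> \<int>" for C by (simp add: class_weight_def)
  then have "(\<Sum>C\<in>form_classes D. 12 * class_weight C) \<in> \<int>" by (intro Ints_sum) blast
  then show ?thesis by (simp add: hurwitz_class_number_def sum_distrib_left)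
qed

lemma hurwitz_class_number_integral_at:
  assumes "prime l" "l > 3"
  shows "hurwitz_class_number D \<in> integral_at l"
proof (rule integral_at_divisor [OF assms(1), of 12])
  have "\<not> l dvd 2" "\<not> l dvd 3" using assms by (auto dest: zdvd_imp_le)
  then have "\<not> l dvd 2 * (2 * 3)" using assms(1) by (simp only: prime_dvd_mult_iff simp_thms)
  then show "\<not> l dvd 12" by simp
  show "of_int 12 * hurwitz_class_number D \<in> \<int>" using hurwitz_class_number_denominator by simp
qed

section \<open>Congruences modulo powers of \<open>l\<close>\<close>

lemma rat_cong_zeroI:
  assumes "prime l" "k \<ge> m" "x = of_int (l ^ k) * z" "x \<in> integral_at l"
    and "of_int (l ^ (k - m)) * z \<in> integral_at l"
  shows "rat_cong l x 0 (l ^ m)"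
proof -
  have "0 \<in> integral_at l"
    using assms(1) by (intro integral_at_divisor [of l 1]) (auto dest: not_prime_unit)
  moreover have "x - 0 = of_int (l ^ m) * (of_int (l ^ (k - m)) * z)"
    using assms(2,3) by (simp add: power_add [symmetric] mult.assoc [symmetric])
  ultimately show ?thesis unfolding rat_cong_def using assms by blast
qed

lemma hurwitz_cong_zero:
  assumes l: "prime l" "l > 3" and D: "\<not> l dvd D" "l dvd s\<^sup>2 + D" and "m \<le> k"
  shows "rat_cong l (hurwitz_class_number (l ^ (2 * k) * D)) 0 (l ^ m)"
proof -
  have "D \<noteq> 0" using D(1) by auto
  have eq: "hurwitz_class_number (l ^ (2 * j) * D) = of_int (l ^ j) * hurwitz_class_number D" for j
  proof (cases "D > 0")
    case True
    then show ?thesis using hurwitz_split_power [OF l(1) _ _ D] l by simp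
  next
    \<comment> \<open>For negative \<open>D\<close> both sides are 0 by convention.\<close>
    case False
    then have "D < 0" using \<open>D \<noteq> 0\<close> by simp
    moreover have "l ^ (2 * j) * D < 0" using \<open>D < 0\<close> l(2) by (simp add: mult_pos_neg)
    ultimately show ?thesis using l(2) by (simp add: hurwitz_class_number_def)
  qed
  note int = hurwitz_class_number_integral_at [OF l]
  show ?thesis
    \<comment> \<open>The cofactor \<open>l^(k - m) H(D)\<close> is itself a Hurwitz class number by
      \<open>eq\<close>, taken at \<open>j = k - m\<close>, and hence
      \<open>l\<close>-integral.\<close>
    by (rule rat_cong_zeroI [OF l(1) \<open>m \<le> k\<close> eq int]) (simp only: eq [symmetric] int)
qed

text \<open>Since \<open>e > c\<close>, the argument is \<open>l^c D\<close> with \<open>D\<close>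
  congruent to \<open>u\<close> modulo \<open>l\<close>; hence \<open>-D\<close> is a nonzero square
  modulo \<open>l\<close> for every \<open>n\<close>.\<close>

lemma hurwitz_progression_cong_zero:
  fixes l u n :: int
  assumes l: "prime l" "l > 3" and "e > c" "coprime l u" "even c" "c \<ge> 2 * m" "QuadRes l (- u)"
  shows "rat_cong l (hurwitz_class_number (l ^ e * n + l ^ c * u)) 0 (l ^ m)"
proof -
  obtain k where k: "c = 2 * k" using \<open>even c\<close> by blast
  define D where "D = l ^ (e - c) * n + u"
  have div: "l dvd l ^ (e - c) * n" using \<open>e > c\<close> by simp
  obtain s where "[s\<^sup>2 = - u] (mod l)" using \<open>QuadRes l (- u)\<close> unfolding QuadRes_def by blast
  then have "l dvd s\<^sup>2 + u" by (simp add: cong_iff_dvd_diff)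
  then have "l dvd s\<^sup>2 + u + l ^ (e - c) * n" using div by (rule dvd_add)
  then have "l dvd s\<^sup>2 + D" by (simp add: D_def algebra_simps)
  moreover have "\<not> l dvd D"
  proof
    assume "l dvd D"
    then have "l dvd u" using div unfolding D_def by (simp only: dvd_add_right_iff)
    then show False using \<open>coprime l u\<close> l(1) by (meson coprime_absorb_left not_prime_unit)
  qed
  moreover have "l ^ e * n + l ^ c * u = l ^ (2 * k) * D"
    using \<open>e > c\<close> by (simp add: D_def k [symmetric] distrib_left mult.assoc [symmetric] power_add [symmetric])
  ultimately show ?thesis using hurwitz_cong_zero [OF l] \<open>c \<ge> 2 * m\<close> k by simp
qed

theorem mainTheorem2:
  shows "(\<forall>(l::int) (m::nat) (e::nat) (c::nat) (u::int) (a::int) (b::int).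
            prime l \<and> l > 3 \<and> m \<ge> 1 \<and> a = l ^ e \<and> b = l ^ c * u \<and>
            e > c \<and> c \<ge> 2 \<and> coprime l u \<and>
            even c \<and> c \<ge> 2 * m \<and> QuadRes l (- u) \<longrightarrow>
            (\<forall>n::int. rat_cong l (hurwitz_class_number (a * n + b)) 0 (l ^ m)))
       \<and> (\<forall>l::int. prime l \<and> l > 3 \<longrightarrow>
            (\<exists>(a::int) (b::int). a \<ge> 1 \<and> QuadRes a (- b) \<and>
               (\<forall>n::int. rat_cong l (hurwitz_class_number (a * n + b)) 0 l)))"
proof (intro conjI allI impI)
  fix l :: int and m e c :: nat and u a b n :: int
  assume "prime l \<and> l > 3 \<and> m \<ge> 1 \<and> a = l ^ e \<and> b = l ^ c * u \<and>
            e > c \<and> c \<ge> 2 \<and> coprime l u \<and>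
            even c \<and> c \<ge> 2 * m \<and> QuadRes l (- u)"
  then show "rat_cong l (hurwitz_class_number (a * n + b)) 0 (l ^ m)"
    using hurwitz_progression_cong_zero by blast
next
  fix l :: int
  assume "prime l \<and> l > 3"
  then have l: "prime l" "l > 3" by auto
  have square: "QuadRes p (q\<^sup>2)" for p q unfolding QuadRes_def by (intro exI [of _ q] cong_refl)
  \<comment> \<open>The instance \<open>m = 1\<close>, \<open>c = 2\<close>, \<open>e = 3\<close>,
    \<open>u = -1\<close>: here \<open>-u = 1\<close> is a square, and \<open>-b = l^2\<close> is a
    square modulo any \<open>a\<close>.\<close>
  have "rat_cong l (hurwitz_class_number (l ^ 3 * n + l ^ 2 * (-1))) 0 (l ^ 1)" for n
    by (rule hurwitz_progression_cong_zero [OF l]) (use square [of l 1] in simp_all)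
  then show "\<exists>a b. a \<ge> 1 \<and> QuadRes a (- b) \<and>
      (\<forall>n. rat_cong l (hurwitz_class_number (a * n + b)) 0 l)"
    using square [of "l ^ 3" l] l by (intro exI [of _ "l ^ 3"] exI [of _ "- (l ^ 2)"]) simp
qed

end
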